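(* Let $H$ be a finite simple graph with $\Delta(H)\le 2$, and let $G$ be obtained from $H$ by gluing in vertex-disjoint copies of $K_4$, i.e. there are pairwise disjoint $4$-element subsets $Y_1,\dots,Y_q\subseteq V(H)$ and $G$ has vertex set $V(H)$ and edge set $E(H)\cup\{uv: u\neq v,\ u,v\in Y_j \text{ for some } j\}$. Let $\mathcal{T}$ be the set of triangles of $H$. Then there is a set of vertices $Z$ with $|Z|\le |\mathcal{T}|/4$, containing at most one vertex from each cycle of $H$, such that $\chi(G-Z)\le 4$. Moreover, $|V(G)\setminus Z|\ge \tfrac{11}{12}|V(G)|$.
   Context: All graphs are finite and simple; the cycles of $H$ are its cycle components. *)

theory Defs
  imports Complex_Main
begin

definition simple_graph :: "'a set \<Rightarrow> ('a \<Rightarrow> 'a \<Rightarrow> bool) \<Rightarrow> bool" where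
  "simple_graph V E \<longleftrightarrow> finite V \<and> (\<forall>x y. E x y \<longrightarrow> x \<in> V \<and> y \<in> V \<and> x \<noteq> y \<and> E y x)"

definition degree :: "('a \<Rightarrow> 'a \<Rightarrow> bool) \<Rightarrow> 'a \<Rightarrow> nat" where
  "degree E v = card {w. E v w}"

definition max_degree_le :: "'a set \<Rightarrow> ('a \<Rightarrow> 'a \<Rightarrow> bool) \<Rightarrow> nat \<Rightarrow> bool" where
  "max_degree_le V E d \<longleftrightarrow> (\<forall>v\<in>V. degree E v \<le> d)"

definition component :: "'a set \<Rightarrow> ('a \<Rightarrow> 'a \<Rightarrow> bool) \<Rightarrow> 'a set \<Rightarrow> bool" where
  "component V E C \<longleftrightarrow> (\<exists>u\<in>V. C = {v. E\<^sup>*\<^sup>* u v})"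

text \<open>A cycle of H = a component inducing a cycle, i.e. a connected 2-regular component.\<close>
definition cycle_component :: "'a set \<Rightarrow> ('a \<Rightarrow> 'a \<Rightarrow> bool) \<Rightarrow> 'a set \<Rightarrow> bool" where
  "cycle_component V E C \<longleftrightarrow> component V E C \<and> (\<forall>v\<in>C. degree E v = 2)"

definition triangles :: "'a set \<Rightarrow> ('a \<Rightarrow> 'a \<Rightarrow> bool) \<Rightarrow> 'a set set" where
  "triangles V E = {T. T \<subseteq> V \<and> card T = 3 \<and> (\<forall>x\<in>T. \<forall>y\<in>T. x \<noteq> y \<longrightarrow> E x y)}"

definition glue_K4 :: "('a \<Rightarrow> 'a \<Rightarrow> bool) \<Rightarrow> (nat \<Rightarrow> 'a set) \<Rightarrow> nat \<Rightarrow> 'a \<Rightarrow> 'a \<Rightarrow> bool" where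
  "glue_K4 E Y q x y \<longleftrightarrow> E x y \<or> (x \<noteq> y \<and> (\<exists>j<q. x \<in> Y j \<and> y \<in> Y j))"

definition colorable :: "'a set \<Rightarrow> ('a \<Rightarrow> 'a \<Rightarrow> bool) \<Rightarrow> nat \<Rightarrow> bool" where
  "colorable V E k \<longleftrightarrow> (\<exists>c :: 'a \<Rightarrow> nat. (\<forall>v\<in>V. c v < k) \<and>
      (\<forall>x\<in>V. \<forall>y\<in>V. E x y \<longrightarrow> c x \<noteq> c y))"

definition chromatic_number :: "'a set \<Rightarrow> ('a \<Rightarrow> 'a \<Rightarrow> bool) \<Rightarrow> nat" where
  "chromatic_number V E = (LEAST k. colorable V E k)"

end

(*
  Give every vertex outside the sets Y j a block of its own. By Hall's theorem, with deficiency
  counted by the triangles, all cycles but at most a quarter of the number of triangles get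
  representatives in distinct blocks; delete a vertex from each of the others. It then suffices to find an independent
  set W with at most one vertex in each block that meets every cycle and every block of size 4:
  removing W leaves a linear forest with blocks of size at most 3, which is 3-colorable, and W is the
  fourth color class. The same 3-colorability, applied after removing the representatives, yields an
  independent W meeting all blocks of size 4, and exchanging vertices for representatives makes it
  meet all cycles.

  The 3-colorability of a path plus disjoint triples (a case of the cycle-plus-triangles theorem of
  Fleischner and Stiebitz) is proved with colors in GF(4)*. The sum of x_0 * prod (x_i + x_(i+1))
  over all colorings that are rainbow on the triples equals the parity of the number of ways to
  drop one vertex of each triple such that the remaining two vertices of each triple enclose an even
  number of remaining vertices. This number is odd because the interlacement relation is symmetric
  and summing it over the vertex dropped from one triple gives 0 modulo 2.
*)
theory Submission
  imports Defs "HOL-Library.Z2" "HOL-Library.FuncSet" "HOL-Library.Disjoint_Sets"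
begin

section \<open>A parity lemma\<close>

lemma sum_PiE_insert:
  fixes F :: "('i \<Rightarrow> 'b) \<Rightarrow> 'c::comm_monoid_add"
  assumes "i \<notin> J"
  shows "(\<Sum>R\<in>PiE (insert i J) B. F R) = (\<Sum>R\<in>PiE J B. \<Sum>x\<in>B i. F (R(i := x)))"
proof -
  have "(\<Sum>R\<in>PiE (insert i J) B. F R) = (\<Sum>(x, R)\<in>B i \<times> PiE J B. F (R(i := x)))"
    unfolding PiE_insert_eq
    by (subst sum.reindex) (use inj_combinator[OF assms] in \<open>auto simp: case_prod_unfold\<close>)
  also have "\<dots> = (\<Sum>R\<in>PiE J B. \<Sum>x\<in>B i. F (R(i := x)))"
    by (subst sum.cartesian_product[symmetric], subst sum.swap) simp
  finally show ?thesis .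
qed

context
  fixes I :: "'i set" and B :: "'i \<Rightarrow> 'b set" and e :: "'i \<Rightarrow> 'i \<Rightarrow> 'b \<Rightarrow> 'b \<Rightarrow> bit"
  assumes fin: "finite I" "\<And>i. i \<in> I \<Longrightarrow> finite (B i)"
    and sym: "\<And>i j x y. i \<in> I \<Longrightarrow> j \<in> I \<Longrightarrow> i \<noteq> j \<Longrightarrow> x \<in> B i \<Longrightarrow> y \<in> B j \<Longrightarrow> e i j x y = e j i y x"
    and zero: "\<And>i j y. i \<in> I \<Longrightarrow> j \<in> I \<Longrightarrow> i \<noteq> j \<Longrightarrow> y \<in> B j \<Longrightarrow> (\<Sum>x\<in>B i. e i j x y) = 0"
begin

private definition factor :: "'i \<Rightarrow> 'i \<Rightarrow> 'b \<Rightarrow> 'b \<Rightarrow> bit" where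
  "factor i j x y = (if i = j then 1 else e i j x y)"

text \<open>One term of the expanded product, for the map \<open>\<phi>\<close> that records which
  summand each factor contributes.\<close>

private definition weight :: "('i \<Rightarrow> 'i) \<Rightarrow> bit" where
  "weight \<phi> = (\<Sum>R\<in>PiE I B. \<Prod>i\<in>I. factor i (\<phi> i) (R i) (R (\<phi> i)))"

text \<open>The value \<open>R i\<close> enters only the factor of \<open>i\<close> and, if
  \<open>\<phi> (\<phi> i) = i\<close>, that of \<open>\<phi> i\<close>. By symmetry these two are
  the same bit, and a bit equals its square. So the product is \<open>e i j x (R j)\<close> times a
  term free of \<open>x\<close>, and summing over \<open>x\<close> gives 0.\<close>

private lemma weight_eq_0:
  assumes \<phi>: "\<phi> \<in> I \<rightarrow>\<^sub>E I" and i: "i \<in> I" "\<phi> i \<noteq> i"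
    and pre: "\<And>k. k \<in> I \<Longrightarrow> \<phi> k = i \<Longrightarrow> k = \<phi> i"
  shows "weight \<phi> = 0"
proof -
  define J where "J = I - {i}"
  define j where "j = \<phi> i"
  have J: "I = insert i J" "i \<notin> J" "finite J" "j \<in> J"
    using fin i \<phi> by (auto simp: J_def j_def)
  have inner: "(\<Sum>x\<in>B i. \<Prod>k\<in>I. factor k (\<phi> k) ((R(i := x)) k) ((R(i := x)) (\<phi> k))) = 0"
    if R: "R \<in> PiE J B" for R
  proof -
    define c where "c = (\<Prod>k\<in>{k\<in>J. \<phi> k \<noteq> i}. factor k (\<phi> k) (R k) (R (\<phi> k)))"
    have Rj: "R j \<in> B j" using R J by auto
    have "(\<Prod>k\<in>I. factor k (\<phi> k) ((R(i := x)) k) ((R(i := x)) (\<phi> k))) = e i j x (R j) * c"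
      if x: "x \<in> B i" for x
    proof -
      have c: "(\<Prod>k\<in>{k\<in>J. \<phi> k \<noteq> i}. factor k (\<phi> k) ((R(i := x)) k) ((R(i := x)) (\<phi> k))) = c"
        unfolding c_def using J by (intro prod.cong) auto
      define S where "S = {k\<in>J. \<phi> k = i}"
      have "S \<subseteq> {j}"
        using pre J(1) unfolding j_def S_def by blast
      moreover have "j \<in> S \<longleftrightarrow> \<phi> j = i"
        using J(4) unfolding S_def by blast
      ultimately have "S = (if \<phi> j = i then {j} else {})"
        by auto
      then have d: "(\<Prod>k\<in>S. factor k (\<phi> k) ((R(i := x)) k) ((R(i := x)) (\<phi> k)))
          = (if \<phi> j = i then e j i (R j) x else 1)"
        using J(4,2) by (auto simp: factor_def)
      have "(\<Prod>k\<in>J. factor k (\<phi> k) ((R(i := x)) k) ((R(i := x)) (\<phi> k)))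
          = (if \<phi> j = i then e j i (R j) x else 1) * c"
        unfolding c[symmetric] d[symmetric] using J(3)
        by (subst prod.union_disjoint[symmetric]) (auto intro!: prod.cong simp: S_def)
      moreover have "e j i (R j) x = e i j x (R j)"
        using sym[of i j x "R j"] J(2,4) i(1) x Rj unfolding J(1) by (metis insertI2)
      ultimately show ?thesis
        using J(3) i by (cases "e i j x (R j)") (auto simp: J(1,2) factor_def j_def[symmetric])
    qed
    then have "(\<Sum>x\<in>B i. \<Prod>k\<in>I. factor k (\<phi> k) ((R(i := x)) k) ((R(i := x)) (\<phi> k)))
        = (\<Sum>x\<in>B i. e i j x (R j) * c)"
      by (rule sum.cong[OF refl])
    also have "\<dots> = (\<Sum>x\<in>B i. e i j x (R j)) * c"
      by (rule sum_distrib_right[symmetric])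
    also have "\<dots> = 0" using zero[of i j "R j"] J(2,4) Rj unfolding J(1) by auto
    finally show ?thesis .
  qed
  have "(\<Sum>R\<in>PiE (insert i J) B. \<Prod>k\<in>I. factor k (\<phi> k) (R k) (R (\<phi> k))) = 0"
    unfolding sum_PiE_insert[OF J(2)] by (rule sum.neutral, rule ballI, rule inner)
  then show ?thesis
    unfolding weight_def by (simp only: J(1)[symmetric])
qed

text \<open>Reindexing the product along \<open>\<phi>\<close> exchanges the two indices of every
  factor, and the factors are symmetric.\<close>

private lemma weight_inverse:
  assumes \<phi>: "bij_betw \<phi> I I" and \<psi>: "\<And>i. i \<in> I \<Longrightarrow> \<psi> (\<phi> i) = i"
  shows "weight \<psi> = weight \<phi>"
  unfolding weight_def
proof (rule sum.cong)
  fix R assume R: "R \<in> PiE I B"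
  have "(\<Prod>i\<in>I. factor i (\<psi> i) (R i) (R (\<psi> i)))
      = (\<Prod>i\<in>I. factor (\<phi> i) (\<psi> (\<phi> i)) (R (\<phi> i)) (R (\<psi> (\<phi> i))))"
    by (rule prod.reindex_bij_betw[OF \<phi>, symmetric])
  also have "\<dots> = (\<Prod>i\<in>I. factor i (\<phi> i) (R i) (R (\<phi> i)))"
  proof (rule prod.cong)
    fix i assume i: "i \<in> I"
    then have "\<phi> i \<in> I" using \<phi> by (auto simp: bij_betw_def)
    then show "factor (\<phi> i) (\<psi> (\<phi> i)) (R (\<phi> i)) (R (\<psi> (\<phi> i))) = factor i (\<phi> i) (R i) (R (\<phi> i))"
      using R i \<psi> sym[of i "\<phi> i" "R i" "R (\<phi> i)"] by (auto simp: factor_def PiE_iff)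
  qed simp
  finally show "(\<Prod>i\<in>I. factor i (\<psi> i) (R i) (R (\<psi> i))) = (\<Prod>i\<in>I. factor i (\<phi> i) (R i) (R (\<phi> i)))" .
qed simp

text \<open>Expanding the product gives one term per map \<open>\<phi>\<close> of \<open>I\<close> into itself, where \<open>\<phi> i = i\<close> stands
  for choosing the summand 1. A point outside the image of \<open>\<phi>\<close>, or one on a 2-cycle of an
  involution, makes the term vanish; the remaining permutations cancel against their inverses.
  Only the identity survives.\<close>

lemma sum_PiE_prod_Suc_degree:
  "(\<Sum>R\<in>PiE I B. \<Prod>i\<in>I. 1 + (\<Sum>j\<in>I - {i}. e i j (R i) (R j))) = (\<Prod>i\<in>I. of_nat (card (B i)))"
proof -
  define Id :: "'i \<Rightarrow> 'i" where "Id = (\<lambda>i\<in>I. i)"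
  \<comment> \<open>Restricting the inverse to \<open>I\<close> keeps it in the extensional function
    space, so that it is an involution there.\<close>
  define inv where "inv = (\<lambda>\<phi>. restrict (inv_into I \<phi>) I)"
  have inv_apply: "inv \<phi> k = inv_into I \<phi> k" if "k \<in> I" for \<phi> k
    using that by (simp add: inv_def)
  define \<Phi> where "\<Phi> = {\<phi> \<in> I \<rightarrow>\<^sub>E I. bij_betw \<phi> I I}"
  define \<Psi> where "\<Psi> = {\<phi> \<in> \<Phi>. inv \<phi> \<noteq> \<phi>}"
  have finF: "finite (I \<rightarrow>\<^sub>E I)" using fin by (simp add: finite_PiE)
  have expand: "(\<Prod>i\<in>I. 1 + (\<Sum>j\<in>I - {i}. e i j (R i) (R j)))
      = (\<Sum>\<phi>\<in>I \<rightarrow>\<^sub>E I. \<Prod>i\<in>I. factor i (\<phi> i) (R i) (R (\<phi> i)))" for R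
  proof -
    have "1 + (\<Sum>j\<in>I - {i}. e i j (R i) (R j)) = (\<Sum>j\<in>I. factor i j (R i) (R j))" if "i \<in> I" for i
    proof -
      have "(\<Sum>j\<in>I - {i}. factor i j (R i) (R j)) = (\<Sum>j\<in>I - {i}. e i j (R i) (R j))"
        by (intro sum.cong) (auto simp: factor_def)
      then show ?thesis using sum.remove[OF fin(1) that, of "\<lambda>j. factor i j (R i) (R j)"]
        by (simp add: factor_def)
    qed
    then have "(\<Prod>i\<in>I. 1 + (\<Sum>j\<in>I - {i}. e i j (R i) (R j))) = (\<Prod>i\<in>I. \<Sum>j\<in>I. factor i j (R i) (R j))"
      by simp
    also have "\<dots> = (\<Sum>\<phi>\<in>I \<rightarrow>\<^sub>E I. \<Prod>i\<in>I. factor i (\<phi> i) (R i) (R (\<phi> i)))"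
      by (rule prod_sum_PiE) (use fin in auto)
    finally show ?thesis .
  qed
  have "(\<Sum>R\<in>PiE I B. \<Prod>i\<in>I. 1 + (\<Sum>j\<in>I - {i}. e i j (R i) (R j))) = (\<Sum>\<phi>\<in>I \<rightarrow>\<^sub>E I. weight \<phi>)"
    unfolding expand weight_def by (rule sum.swap)
  also have "\<dots> = (\<Sum>\<phi>\<in>\<Psi> \<union> {Id}. weight \<phi>)"
  proof (rule sum.mono_neutral_right[OF finF])
    show "\<Psi> \<union> {Id} \<subseteq> I \<rightarrow>\<^sub>E I" by (auto simp: \<Psi>_def \<Phi>_def Id_def)
    show "\<forall>\<phi>\<in>(I \<rightarrow>\<^sub>E I) - (\<Psi> \<union> {Id}). weight \<phi> = 0"
    proof
      fix \<phi> assume asm: "\<phi> \<in> (I \<rightarrow>\<^sub>E I) - (\<Psi> \<union> {Id})"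
      then have \<phi>: "\<phi> \<in> I \<rightarrow>\<^sub>E I" by auto
      show "weight \<phi> = 0"
      proof (cases "bij_betw \<phi> I I")
        case True
        then have "inv \<phi> = \<phi>" using asm by (auto simp: \<Psi>_def \<Phi>_def)
        then have "inv_into I \<phi> k = \<phi> k" if "k \<in> I" for k
          using that by (metis inv_def restrict_apply')
        then have invo: "\<phi> (\<phi> k) = k" if "k \<in> I" for k
          using that True by (metis bij_betw_inv_into_right)
        have "\<exists>i\<in>I. \<phi> i \<noteq> i"
        proof (rule ccontr)
          assume "\<not> ?thesis"
          then have "\<phi> = Id" using \<phi> unfolding Id_def
            by (intro extensionalityI[of _ I]) (auto simp: PiE_def)
          then show False using asm by auto
        qed
        then obtain i where i: "i \<in> I" "\<phi> i \<noteq> i" by auto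
        show ?thesis
          by (rule weight_eq_0[OF \<phi> i]) (use invo in force)
      next
        case False
        have "\<phi> ` I \<noteq> I"
          using False fin(1) by (metis bij_betw_def eq_card_imp_inj_on)
        then obtain i where i: "i \<in> I" "i \<notin> \<phi> ` I" using \<phi> by auto
        have "\<phi> i \<noteq> i" using i by force
        then show ?thesis by (rule weight_eq_0[OF \<phi> i(1)]) (use i in blast)
      qed
    qed
  qed
  also have "\<dots> = (\<Sum>\<phi>\<in>\<Psi>. weight \<phi>) + weight Id"
  proof -
    have "inv Id = Id"
      unfolding inv_def Id_def
      by (rule restrict_ext) (metis inj_on_id2 inj_on_restrict_eq inv_into_f_f restrict_apply')
    then have "Id \<notin> \<Psi>" by (auto simp: \<Psi>_def)
    moreover have "finite \<Psi>" using finF by (auto simp: \<Psi>_def \<Phi>_def)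
    ultimately have "(\<Sum>\<phi>\<in>insert Id \<Psi>. weight \<phi>) = weight Id + (\<Sum>\<phi>\<in>\<Psi>. weight \<phi>)"
      by (intro sum.insert)
    then show ?thesis by (simp only: add.commute Un_insert_right Un_empty_right)
  qed
  also have "(\<Sum>\<phi>\<in>\<Psi>. weight \<phi>) = 0"
  proof (rule sum_involution_eq_0[where h = inv])
    fix \<phi> assume \<phi>: "\<phi> \<in> \<Psi>"
    then have bij: "bij_betw \<phi> I I" and ext: "\<phi> \<in> I \<rightarrow>\<^sub>E I" and ne: "inv \<phi> \<noteq> \<phi>"
      by (auto simp: \<Psi>_def \<Phi>_def)
    have bij': "bij_betw (inv \<phi>) I I"
      unfolding inv_def using bij_betw_inv_into[OF bij] by simp
    show "inv \<phi> \<noteq> \<phi>" by fact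
    have "weight (inv \<phi>) = weight \<phi>"
      by (rule weight_inverse[OF bij])
        (use bij in \<open>auto simp: inv_def bij_betw_def\<close>)
    then show "weight (inv \<phi>) + weight \<phi> = 0" by (cases "weight \<phi>") auto
    show inv_inv: "inv (inv \<phi>) = \<phi>"
    proof (rule extensionalityI[of _ I])
      fix k assume k: "k \<in> I"
      have "inv (inv \<phi>) k \<in> I" "inv \<phi> (inv (inv \<phi>) k) = k"
        using k bij_betw_inv_into_right[OF bij' k] bij_betw_apply[OF bij_betw_inv_into[OF bij'] k]
        by (simp_all add: inv_apply)
      moreover have "\<phi> k \<in> I" "inv \<phi> (\<phi> k) = k"
        using k bij by (auto simp: inv_def bij_betw_def)
      ultimately show "inv (inv \<phi>) k = \<phi> k"
        using inj_onD[OF bij_betw_imp_inj_on[OF bij']] by metis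
    qed (use ext in \<open>auto simp: inv_def PiE_def\<close>)
    have "inv \<phi> \<in> I \<rightarrow>\<^sub>E I" using bij' by (auto simp: inv_def bij_betw_def)
    then show "inv \<phi> \<in> \<Psi>" using bij' ne inv_inv by (auto simp: \<Psi>_def \<Phi>_def)
  qed
  also have "weight Id = (\<Sum>R\<in>PiE I B. 1)"
    unfolding weight_def Id_def by (intro sum.cong refl prod.neutral) (simp add: factor_def)
  also have "0 + (\<Sum>R\<in>PiE I B. 1) = (\<Prod>i\<in>I. of_nat (card (B i)) :: bit)"
    using fin by (simp add: card_PiE)
  finally show ?thesis .
qed

end

section \<open>Counting transversals of triples on a line\<close>

text \<open>\<open>A\<close> is the set of those \<open>i\<close> for which the factor \<open>x i + x (i + 1)\<close> of a path contributes \<open>x i\<close>; then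
  \<open>visits A v\<close> is the exponent of \<open>x v\<close>, where vertex 0 is counted once more.\<close>

definition visits :: "nat set \<Rightarrow> nat \<Rightarrow> nat" where
  "visits A v = (if v \<in> A then 1 else 0) + (if v = 0 \<or> v - 1 \<notin> A then 1 else 0)"

lemma visits_eq_1_iff: "visits A v = 1 \<longleftrightarrow> (v \<in> A \<longleftrightarrow> v \<noteq> 0 \<and> v - 1 \<in> A)"
  by (auto simp: visits_def)

lemma visits_neq_1: "visits A v \<noteq> 1 \<Longrightarrow> visits A v = (if v \<in> A then 2 else 0)"
  by (auto simp: visits_def split: if_splits)

text \<open>Membership in \<open>A\<close> flips exactly at the vertices whose exponent is not 1, so \<open>A\<close> is recovered
  from them as \<open>turned\<close>.\<close>

definition turned :: "nat set \<Rightarrow> nat set" where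
  "turned K = {v. odd (card {y\<in>K. y \<le> v})}"

lemma card_le_eq_card_less:
  fixes K :: "nat set"
  shows "finite K \<Longrightarrow> card {y\<in>K. y \<le> v} = card {y\<in>K. y < v} + of_bool (v \<in> K)"
proof -
  assume "finite K"
  moreover have "{y\<in>K. y \<le> v} = {y\<in>K. y < v} \<union> (if v \<in> K then {v} else {})"
    by (auto simp: less_le)
  ultimately show ?thesis by auto
qed

text \<open>The parity defining \<open>turned\<close> changes at \<open>v\<close> exactly when
  \<open>v\<close> is in \<open>K\<close>, and exponent 1 means that membership does not change at
  \<open>v\<close>. Vertex 0 counts as preceded by a nonmember.\<close>

lemma visits_turned_iff:
  assumes "finite K"
  shows "visits (turned K) v = 1 \<longleftrightarrow> v \<notin> K"
proof (cases v)
  case 0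
  then show ?thesis
    using card_le_eq_card_less[OF assms, of v] unfolding visits_eq_1_iff turned_def by auto
next
  case (Suc u)
  have "{y\<in>K. y < v} = {y\<in>K. y \<le> u}" using Suc by auto
  then show ?thesis
    using Suc card_le_eq_card_less[OF assms, of v] unfolding visits_eq_1_iff turned_def by auto
qed

lemma mem_iff_turned:
  assumes "K = {v. v < N \<and> visits A v \<noteq> 1}" "v < N"
  shows "v \<in> A \<longleftrightarrow> v \<in> turned K"
  using assms(2)
proof (induction v)
  case 0
  have "finite K" using assms by auto
  then show ?case
    using assms(1) 0 card_le_eq_card_less[of K 0] by (auto simp: visits_def turned_def)
next
  case (Suc u)
  have "finite K" using assms by auto
  have "{y\<in>K. y < Suc u} = {y\<in>K. y \<le> u}" by auto
  then have "Suc u \<in> turned K \<longleftrightarrow> (u \<in> turned K) \<noteq> (Suc u \<in> K)"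
    using card_le_eq_card_less[OF \<open>finite K\<close>, of "Suc u"] unfolding turned_def by auto
  also have "Suc u \<in> K \<longleftrightarrow> (Suc u \<in> A) \<noteq> (u \<in> A)"
    using Suc.prems assms(1) visits_eq_1_iff[of A "Suc u"] by auto
  also have "u \<in> turned K \<longleftrightarrow> u \<in> A" using Suc by auto
  finally show ?case by auto
qed

context
  fixes N :: nat and I :: "'i set" and b :: "nat \<Rightarrow> 'i" and B :: "'i \<Rightarrow> nat set"
  defines "B \<equiv> \<lambda>i. {v. v < N \<and> b v = i}"
  assumes finI: "finite I" and b_in: "\<And>v. v < N \<Longrightarrow> b v \<in> I"
    and card_B: "\<And>i. i \<in> I \<Longrightarrow> card (B i) = 3"
begin

private lemma finB: "finite (B i)"
  unfolding B_def by auto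

private lemma UN_B: "(\<Union>i\<in>I. B i) = {..<N}"
  using b_in by (auto simp: B_def)

private lemma disj_B: "i \<noteq> j \<Longrightarrow> B i \<inter> B j = {}"
  by (auto simp: B_def)

text \<open>Here \<open>R\<close> names the vertex dropped from each triple.\<close>

private definition kept :: "('i \<Rightarrow> nat) \<Rightarrow> nat set" where
  "kept R = {..<N} - R ` I"

private lemma kept_Int_B:
  assumes "R \<in> PiE I B" "i \<in> I"
  shows "kept R \<inter> B i = B i - {R i}"
  using assms by (auto simp: kept_def B_def PiE_iff)

private lemma kept_eq_UN:
  assumes "R \<in> PiE I B"
  shows "kept R = (\<Union>i\<in>I. B i - {R i})"
proof -
  have "kept R = (\<Union>i\<in>I. kept R \<inter> B i)"
    using UN_B by (auto simp: kept_def)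
  then show ?thesis using kept_Int_B[OF assms] by auto
qed

private lemma card_kept: "R \<in> PiE I B \<Longrightarrow> card (kept R) = 2 * card I"
proof -
  assume R: "R \<in> PiE I B"
  have "card (kept R) = (\<Sum>i\<in>I. card (B i - {R i}))"
    unfolding kept_eq_UN[OF R] by (rule card_UN_disjoint) (use finI finB disj_B in auto)
  also have "\<dots> = (\<Sum>i\<in>I. 2)"
    using R card_B finB by (intro sum.cong) (auto simp: PiE_iff)
  finally show ?thesis by simp
qed

text \<open>Interlacement: for distinct triples \<open>i\<close>, \<open>j\<close> and dropped
  vertices \<open>x\<close>, \<open>y\<close>, this is 1 exactly when the two remaining pairs
  alternate on the line. Nested pairs give 2 and separated pairs 0 or 4, all even.\<close>

private definition cross :: "'i \<Rightarrow> 'i \<Rightarrow> nat \<Rightarrow> nat \<Rightarrow> bit" where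
  "cross i j x y = (\<Sum>u\<in>B i - {x}. \<Sum>v\<in>B j - {y}. of_bool (u < v))"

text \<open>Each of the four pairs \<open>(u, v)\<close> is ordered in exactly one of the two ways,
  so the two counts add up to 4.\<close>

private lemma cross_sym:
  assumes "i \<in> I" "j \<in> I" "i \<noteq> j" "x \<in> B i" "y \<in> B j"
  shows "cross i j x y = cross j i y x"
proof -
  have "cross j i y x = (\<Sum>u\<in>B i - {x}. \<Sum>v\<in>B j - {y}. of_bool (v < u))"
    unfolding cross_def by (rule sum.swap)
  then have "cross i j x y + cross j i y x
      = (\<Sum>u\<in>B i - {x}. \<Sum>v\<in>B j - {y}. of_bool (u < v) + of_bool (v < u))"
    unfolding cross_def by (simp only: sum.distrib)
  also have "\<dots> = (\<Sum>u\<in>B i - {x}. \<Sum>v\<in>B j - {y}. 1)"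
  proof (intro sum.cong refl)
    fix u v assume "u \<in> B i - {x}" "v \<in> B j - {y}"
    then have "u \<noteq> v" using disj_B[OF assms(3)] by auto
    then show "of_bool (u < v) + of_bool (v < u) = (1 :: bit)" by (cases "u < v") auto
  qed
  also have "\<dots> = 0" using assms card_B finB by simp
  finally show ?thesis by (cases "cross i j x y"; cases "cross j i y x") auto
qed

text \<open>Each \<open>u\<close> in \<open>B i\<close> is counted under the two choices of
  \<open>x\<close> other than \<open>u\<close>, so its contributions cancel modulo 2.\<close>

private lemma cross_sum:
  assumes "i \<in> I"
  shows "(\<Sum>x\<in>B i. cross i j x y) = 0"
proof -
  define F :: "nat \<Rightarrow> bit" where "F u = (\<Sum>v\<in>B j - {y}. of_bool (u < v))" for u
  have "(\<Sum>x\<in>B i. cross i j x y) = (\<Sum>x\<in>B i. (\<Sum>u\<in>B i. F u) + F x)"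
  proof (intro sum.cong refl)
    fix x assume "x \<in> B i"
    then have "(\<Sum>u\<in>B i. F u) = F x + (\<Sum>u\<in>B i - {x}. F u)"
      by (intro sum.remove finB)
    then show "cross i j x y = (\<Sum>u\<in>B i. F u) + F x"
      unfolding cross_def F_def[symmetric] by (cases "F x"; cases "\<Sum>u\<in>B i - {x}. F u") auto
  qed
  also have "\<dots> = of_nat (card (B i)) * (\<Sum>u\<in>B i. F u) + (\<Sum>x\<in>B i. F x)"
    by (simp only: sum.distrib sum_constant)
  also have "\<dots> = 0" using card_B[OF assms] by (cases "\<Sum>u\<in>B i. F u") auto
  finally show ?thesis .
qed

text \<open>Modulo 2, kept vertices before both remaining vertices of the triple cancel, and the
  first of the two is counted for the second. An odd value thus means that they enclose an even
  number of kept vertices.\<close>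

private definition before :: "('i \<Rightarrow> nat) \<Rightarrow> 'i \<Rightarrow> nat" where
  "before R i = (\<Sum>x\<in>B i - {R i}. card {y\<in>kept R. y < x})"

private lemma card_bit: "finite S \<Longrightarrow> (of_nat (card {y\<in>S. P y}) :: bit) = (\<Sum>y\<in>S. of_bool (P y))"
  by (subst sum_of_bool_eq) (auto simp: Int_def conj_commute)

text \<open>With the kept vertices split by triples, every other triple contributes its
  interlacement parity and the triple itself the constant 1. This is the shape of the factors in
  \<open>sum_PiE_prod_Suc_degree\<close>.\<close>

private lemma before_eq:
  assumes R: "R \<in> PiE I B" and i: "i \<in> I"
  shows "(of_nat (before R i) :: bit) = 1 + (\<Sum>j\<in>I - {i}. cross i j (R i) (R j))"
proof -
  have "(of_nat (before R i) :: bit) = (\<Sum>x\<in>B i - {R i}. \<Sum>y\<in>kept R. of_bool (y < x))"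
    unfolding before_def of_nat_sum by (intro sum.cong refl card_bit) (simp add: kept_def)
  also have "\<dots> = (\<Sum>x\<in>B i - {R i}. \<Sum>j\<in>I. \<Sum>y\<in>B j - {R j}. of_bool (y < x))"
    unfolding kept_eq_UN[OF R]
    by (intro sum.cong refl sum.UNION_disjoint) (use finI finB disj_B in auto)
  also have "\<dots> = (\<Sum>j\<in>I. \<Sum>x\<in>B i - {R i}. \<Sum>y\<in>B j - {R j}. of_bool (y < x))"
    by (rule sum.swap)
  also have "\<dots> = (\<Sum>j\<in>I. cross j i (R j) (R i))"
    unfolding cross_def by (intro sum.cong refl sum.swap)
  also have "\<dots> = cross i i (R i) (R i) + (\<Sum>j\<in>I - {i}. cross j i (R j) (R i))"
    by (rule sum.remove[OF finI i])
  also have "(\<Sum>j\<in>I - {i}. cross j i (R j) (R i)) = (\<Sum>j\<in>I - {i}. cross i j (R i) (R j))"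
    using R i by (intro sum.cong refl cross_sym) auto
  \<comment> \<open>Of the ordered pairs formed from the two remaining vertices, exactly one is
    increasing.\<close>
  also have "cross i i (R i) (R i) = 1"
  proof -
    have "card (B i - {R i}) = 2" using R i card_B finB by (simp add: PiE_iff)
    then obtain p q where "B i - {R i} = {p, q}" "p \<noteq> q" by (auto simp: card_2_iff)
    then show ?thesis unfolding cross_def by (cases "p < q") auto
  qed
  finally show ?thesis .
qed

text \<open>The parity lemma with \<open>cross\<close> for \<open>e\<close> evaluates the count to a
  product of block sizes, each of which is 3.\<close>

private lemma odd_card_transversals: "odd (card {R \<in> PiE I B. \<forall>i\<in>I. odd (before R i)})"
proof -
  have finR: "finite (PiE I B)" using finI finB by (simp add: finite_PiE)
  have ind: "of_bool (\<forall>i\<in>I. odd (before R i)) = (\<Prod>i\<in>I. of_nat (before R i) :: bit)" for R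
  proof -
    have "(of_nat n :: bit) = of_bool (odd n)" for n
      by (induction n) auto
    then show ?thesis using finI by (auto simp: of_bool_def intro!: prod.neutral[symmetric])
  qed
  have "(of_nat (card {R \<in> PiE I B. \<forall>i\<in>I. odd (before R i)}) :: bit)
      = (\<Sum>R\<in>PiE I B. of_bool (\<forall>i\<in>I. odd (before R i)))"
    by (rule card_bit[OF finR])
  also have "\<dots> = (\<Sum>R\<in>PiE I B. \<Prod>i\<in>I. 1 + (\<Sum>j\<in>I - {i}. cross i j (R i) (R j)))"
    unfolding ind by (intro sum.cong refl prod.cong) (use before_eq in auto)
  also have "\<dots> = (\<Prod>i\<in>I. of_nat (card (B i)))"
    by (rule sum_PiE_prod_Suc_degree) (use finI finB cross_sym cross_sum in auto)
  also have "\<dots> = 1" by (intro prod.neutral) (simp add: card_B)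
  finally show ?thesis by (auto dest: arg_cong[of _ _ even])
qed

text \<open>\<open>turned\<close> also counts the vertex itself while \<open>before\<close> does
  not; the two extra ones cancel.\<close>

private lemma before_odd_iff:
  assumes "B i = {p, q, r}" "p \<noteq> q" "p \<noteq> r" "q \<noteq> r" "R i = r" "p \<in> kept R" "q \<in> kept R"
  shows "odd (before R i) \<longleftrightarrow> (p \<in> turned (kept R)) \<noteq> (q \<in> turned (kept R))"
proof -
  have "finite (kept R)" by (simp add: kept_def)
  note * = card_le_eq_card_less[OF this, of p] card_le_eq_card_less[OF this, of q]
  have "B i - {R i} = {p, q}" using assms by auto
  then show ?thesis using * assms by (auto simp: before_def turned_def)
qed

text \<open>The sets \<open>A\<close> correspond bijectively to the transversals just counted: the
  dropped vertices are those with exponent 1, and an odd \<open>before\<close> says that of the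
  other two vertices of a triple one has exponent 0 and one has exponent 2.\<close>

lemma odd_card_rainbow_visits:
  assumes "N = Suc M"
  shows "odd (card {A \<in> Pow {..<M}. \<forall>i\<in>I. visits A ` B i = {0, 1, 2}})"
proof -
  define T where "T = {R \<in> PiE I B. \<forall>i\<in>I. odd (before R i)}"
  define S where "S = {A \<in> Pow {..<M}. \<forall>i\<in>I. visits A ` B i = {0, 1, 2}}"
  define G where "G R = turned (kept R) \<inter> {..<N}" for R
  have fin_kept: "finite (kept R)" for R by (simp add: kept_def)
  have visG: "visits (G R) v = visits (turned (kept R)) v" if "v < N" for R v
    using that by (auto simp: visits_def G_def)
  have "inj_on G T"
  proof (rule inj_onI)
    fix R R' assume R: "R \<in> T" "R' \<in> T" "G R = G R'"
    have "v \<in> kept R \<longleftrightarrow> v \<in> kept R'" if "v < N" for v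
      using visG[OF that] visits_turned_iff[OF fin_kept] R(3) by metis
    then have eq: "kept R = kept R'" by (auto simp: kept_def)
    show "R = R'"
    proof (rule PiE_ext)
      show "R \<in> PiE I B" "R' \<in> PiE I B" using R by (auto simp: T_def)
      fix i assume i: "i \<in> I"
      have "B i - {R i} = B i - {R' i}"
        using R i eq kept_Int_B unfolding T_def by (metis (mono_tags, lifting) mem_Collect_eq)
      moreover have "R i \<in> B i" using R i by (auto simp: T_def)
      ultimately show "R i = R' i" by auto
    qed
  qed
  moreover have "G ` T = S"
  proof (intro equalityI subsetI)
    fix A assume "A \<in> G ` T"
    then obtain R where R: "R \<in> PiE I B" "\<And>i. i \<in> I \<Longrightarrow> odd (before R i)" and A: "A = G R"
      by (auto simp: T_def)
    \<comment> \<open>The last vertex \<open>M\<close> has no edge after it, so it must stay outside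
      \<open>A\<close>. It does because the number of kept vertices is even.\<close>
    have "{y\<in>kept R. y \<le> M} = kept R" using assms unfolding kept_def by auto
    then have "M \<notin> turned (kept R)" using card_kept[OF R(1)] by (simp add: turned_def)
    then have "A \<in> Pow {..<M}" using A assms by (auto simp: G_def less_Suc_eq)
    moreover have "visits A ` B i = {0, 1, 2}" if i: "i \<in> I" for i
    proof -
      have ri: "R i \<in> B i" using R i by auto
      have "card (B i - {R i}) = 2" using ri i card_B finB by simp
      then obtain p q where pq: "B i - {R i} = {p, q}" "p \<noteq> q" by (auto simp: card_2_iff)
      have Bi: "B i = {p, q, R i}" using pq ri by auto
      have kept: "p \<in> kept R" "q \<in> kept R" "R i \<notin> kept R"
        using kept_Int_B[OF R(1) i] pq i by (auto simp: kept_def)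
      have lt: "p < N" "q < N" "R i < N" using Bi by (auto simp: B_def)
      have "visits A (R i) = 1" "visits A p \<noteq> 1" "visits A q \<noteq> 1"
        using visits_turned_iff[OF fin_kept[of R]] kept visG lt unfolding A by simp_all
      moreover have "(p \<in> A) \<noteq> (q \<in> A)"
        using before_odd_iff[OF Bi pq(2) _ _ refl kept(1,2)] pq R(2)[OF i] lt
        by (auto simp: A G_def)
      ultimately show ?thesis
        using visits_neq_1[of A p] visits_neq_1[of A q] unfolding Bi by auto
    qed
    ultimately show "A \<in> S" by (auto simp: S_def)
  next
    fix A assume "A \<in> S"
    then have A: "A \<subseteq> {..<M}" and rb: "\<And>i. i \<in> I \<Longrightarrow> visits A ` B i = {0, 1, 2}"
      by (auto simp: S_def)
    define K where "K = {v. v < N \<and> visits A v \<noteq> 1}"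
    have inj: "inj_on (visits A) (B i)" if "i \<in> I" for i
      using that rb card_B finB by (intro eq_card_imp_inj_on) auto
    define R where "R = (\<lambda>i\<in>I. SOME v. v \<in> B i \<and> visits A v = 1)"
    have Ri: "R i \<in> B i \<and> visits A (R i) = 1" if "i \<in> I" for i
    proof -
      have "\<exists>v. v \<in> B i \<and> visits A v = 1" using rb[OF that] by (metis imageE insertCI)
      from someI_ex[OF this] show ?thesis using that by (simp add: R_def)
    qed
    have Rmem: "R \<in> PiE I B" using Ri by (auto simp: R_def)
    have uniq: "v = R (b v)" if "v < N" "visits A v = 1" for v
      using inj_onD[OF inj, of "b v" v "R (b v)"] that Ri[of "b v"] b_in[OF that(1)]
      by (auto simp: B_def)
    have K: "kept R = K"
      using uniq b_in Ri by (force simp: kept_def K_def)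
    have turned: "v \<in> A \<longleftrightarrow> v \<in> turned K" if "v < N" for v
      using mem_iff_turned[OF K_def that] .
    have "G R = A"
      using turned A assms unfolding G_def K by auto
    moreover have "odd (before R i)" if i: "i \<in> I" for i
    proof -
      obtain p q where pq: "p \<in> B i" "q \<in> B i" "visits A p = 0" "visits A q = 2"
        using rb[OF i] by (metis imageE insertCI)
      have "p \<noteq> q" "p \<noteq> R i" "q \<noteq> R i" using pq Ri[OF i] by auto
      moreover from this have "{p, q, R i} = B i"
        using pq Ri[OF i] card_B[OF i] finB by (intro card_subset_eq) auto
      moreover have "p < N" "q < N" using pq by (auto simp: B_def)
      moreover have "p \<notin> A" "q \<in> A"
        using pq(3,4) visits_neq_1[of A p] visits_neq_1[of A q] by (simp_all split: if_splits)
      moreover have "p \<in> kept R" "q \<in> kept R"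
        using pq \<open>p < N\<close> \<open>q < N\<close> unfolding K by (simp_all add: K_def)
      ultimately show ?thesis
        using before_odd_iff[of i p q "R i" R] turned unfolding K by metis
    qed
    ultimately show "A \<in> G ` T" using Rmem by (auto simp: T_def)
  qed
  ultimately have "card S = card T" by (metis card_image)
  then show ?thesis using odd_card_transversals by (simp add: S_def T_def)
qed

end

section \<open>Three-coloring a linear forest plus triples\<close>

text \<open>The field with four elements; \<open>GF4 a b\<close> stands for \<open>a + b \<omega>\<close> with \<open>\<omega>\<^sup>2 = \<omega> + 1\<close>.\<close>

datatype gf4 = GF4 (re4: bit) (im4: bit)

instantiation gf4 :: comm_ring_1
begin

definition "0 = GF4 0 0"
definition "1 = GF4 1 0"
definition "x + y = GF4 (re4 x + re4 y) (im4 x + im4 y)"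
definition "- x = (x :: gf4)"
definition "x - y = x + (y :: gf4)"
definition "x * y = GF4 (re4 x * re4 y + im4 x * im4 y)
  (re4 x * im4 y + im4 x * re4 y + im4 x * im4 y)"

instance
proof
  fix x y z :: gf4
  show "x * y * z = x * (y * z)" "(x + y) * z = x * z + y * z"
    unfolding plus_gf4_def times_gf4_def gf4.sel gf4.inject by (simp_all only: algebra_simps)
  show "x + y + z = x + (y + z)" "x * y = y * x" "x + y = y + x"
    unfolding plus_gf4_def times_gf4_def gf4.sel gf4.inject by (simp_all only: algebra_simps)
  show "- x + x = 0" "0 + x = x" "1 * x = x"
    by (cases x; simp add: plus_gf4_def times_gf4_def zero_gf4_def one_gf4_def uminus_gf4_def)+
  show "x - y = x + - y" "(0::gf4) \<noteq> 1"
    by (simp_all add: zero_gf4_def one_gf4_def uminus_gf4_def minus_gf4_def)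
qed

end

definition omega :: gf4 where "omega = GF4 0 1"

section \<open>Power sums of cube roots of unity in characteristic 2\<close>

lemma gf4_add_self: "x + x = (0::gf4)"
  by (cases x) (simp add: plus_gf4_def zero_gf4_def)

lemma gf4_of_nat: "(of_nat n :: gf4) = of_bool (odd n)"
  by (induction n) (auto simp: gf4_add_self)

lemma omega_power:
  "omega ^ n = (if n mod 3 = 0 then 1 else if n mod 3 = 1 then omega else GF4 1 1)"
proof -
  have "omega ^ 3 = 1" by (simp add: omega_def one_gf4_def times_gf4_def power3_eq_cube)
  then have "omega ^ n = omega ^ (n mod 3)"
    by (metis div_mult_mod_eq mult.commute mult.left_neutral power_add power_mult power_one)
  moreover have "n mod 3 = 0 \<or> n mod 3 = 1 \<or> n mod 3 = 2" by linarith
  ultimately show ?thesis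
    by (auto simp: omega_def one_gf4_def times_gf4_def power2_eq_square)
qed

text \<open>With \<open>x = omega ^ n\<close>: if \<open>x = 1\<close>, the sums are 3 = 1 and 2 =
  0; otherwise \<open>x\<close> is a primitive cube root of unity and 1 + x + x^2 = 0.\<close>

lemma gf4_omega_sums:
  "1 + omega ^ n + (omega ^ n) ^ 2 = of_bool (3 dvd n)"
  "omega ^ n + (omega ^ n) ^ 2 = of_bool (\<not> 3 dvd n)"
proof -
  consider "omega ^ n = 1" "3 dvd n" | "omega ^ n = GF4 0 1" "\<not> 3 dvd n" | "omega ^ n = GF4 1 1" "\<not> 3 dvd n"
    using omega_power[of n] unfolding omega_def by (auto simp: dvd_eq_mod_eq_0 split: if_splits)
  then show "1 + omega ^ n + (omega ^ n) ^ 2 = of_bool (3 dvd n)"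
    "omega ^ n + (omega ^ n) ^ 2 = of_bool (\<not> 3 dvd n)"
    by (cases; simp add: power2_eq_square one_gf4_def plus_gf4_def times_gf4_def zero_gf4_def)+
qed

text \<open>A sum divisible by 3 means that the three values are all equal or all distinct. Since
  \<open>b + 2 * c\<close> is congruent to b - c, the other condition excludes equality.\<close>

lemma exponents_eq_012_iff:
  "\<forall>a\<in>{0, 1, 2}. \<forall>b\<in>{0, 1, 2}. \<forall>c\<in>{0, 1, 2}.
    \<not> 3 dvd b + 2 * c \<and> 3 dvd a + b + c \<longleftrightarrow> {a, b, c} = {0, 1, 2 :: nat}"
  by code_simp

lemma affine_mod_3_neq:
  fixes a b :: nat
  assumes "a < b" "b < 3" "\<alpha> = 1 \<or> \<alpha> = 2"
  shows "(\<alpha> * a + \<beta>) mod 3 \<noteq> (\<alpha> * b + \<beta>) mod 3"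
proof
  assume "(\<alpha> * a + \<beta>) mod 3 = (\<alpha> * b + \<beta>) mod 3"
  moreover have "\<alpha> * a + \<beta> \<le> \<alpha> * b + \<beta>" using assms(1) by simp
  ultimately have "3 dvd (\<alpha> * b + \<beta>) - (\<alpha> * a + \<beta>)"
    by (simp only: mod_eq_dvd_iff_nat[symmetric])
  also have "(\<alpha> * b + \<beta>) - (\<alpha> * a + \<beta>) = \<alpha> * (b - a)"
    by (simp add: diff_mult_distrib2)
  finally have "3 dvd \<alpha> * (b - a)" .
  moreover have "3 dvd x" if "3 dvd 2 * x" for x :: nat
    using that by presburger
  ultimately have "3 dvd b - a" using assms(3) by (metis mult_1)
  then show False using assms(1,2) by (auto dest: dvd_imp_le)
qed

text \<open>The six pairs \<open>(\<alpha>, \<beta>)\<close> give all arrangements of the three cube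
  roots of unity on a triple. Collecting exponents separates slope from shift, and the double sum
  becomes a product of two power sums.\<close>

lemma sum_affine_omega:
  assumes "e0 \<in> {0, 1, 2}" "e1 \<in> {0, 1, 2}" "e2 \<in> {0, 1, 2 :: nat}"
  shows "(\<Sum>(\<alpha>, \<beta>)\<in>{1, 2} \<times> {0, 1, 2}.
      (omega ^ \<beta>) ^ e0 * (omega ^ (\<alpha> + \<beta>)) ^ e1 * (omega ^ (2 * \<alpha> + \<beta>)) ^ e2)
    = of_bool ({e0, e1, e2} = {0, 1, 2})" (is "?l = _")
proof -
  have "(omega ^ \<beta>) ^ e0 * (omega ^ (\<alpha> + \<beta>)) ^ e1 * (omega ^ (2 * \<alpha> + \<beta>)) ^ e2
      = (omega ^ (e1 + 2 * e2)) ^ \<alpha> * (omega ^ (e0 + e1 + e2)) ^ \<beta>" for \<alpha> \<beta>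
    unfolding power_mult[symmetric] power_add[symmetric]
    by (rule arg_cong[where f = "power omega"]) (simp add: algebra_simps)
  then have l: "?l = (\<Sum>\<alpha>\<in>{1, 2}. (omega ^ (e1 + 2 * e2)) ^ \<alpha>) * (\<Sum>\<beta>\<in>{0, 1, 2}. (omega ^ (e0 + e1 + e2)) ^ \<beta>)"
    by (simp only: sum_product sum.cartesian_product)
  have sums: "(\<Sum>\<alpha>\<in>{1, 2}. x ^ \<alpha>) = x + x ^ 2" "(\<Sum>\<beta>\<in>{0, 1, 2}. x ^ \<beta>) = 1 + x + x ^ 2" for x :: gf4
    by (simp_all add: add.assoc)
  have "?l = of_bool (\<not> 3 dvd e1 + 2 * e2) * of_bool (3 dvd e0 + e1 + e2)"
    unfolding l sums gf4_omega_sums ..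
  also have "\<dots> = of_bool (\<not> 3 dvd e1 + 2 * e2 \<and> 3 dvd e0 + e1 + e2)"
    by simp
  also have "(\<not> 3 dvd e1 + 2 * e2 \<and> 3 dvd e0 + e1 + e2) \<longleftrightarrow> {e0, e1, e2} = {0, 1, 2}"
    by (rule exponents_eq_012_iff[THEN bspec, OF assms(1), THEN bspec, OF assms(2), THEN bspec, OF assms(3)])
  finally show ?thesis .
qed

text \<open>The additional factor \<open>x 0\<close> raises the degree to the number of vertices, as
  needed for exponents 0, 1, 2 on every triple.\<close>

lemma prod_path_expand:
  fixes x :: "nat \<Rightarrow> 'r::comm_semiring_1"
  shows "x 0 * (\<Prod>i<M. x i + x (Suc i)) = (\<Sum>A\<in>Pow {..<M}. \<Prod>v<Suc M. x v ^ visits A v)"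
proof -
  have "x 0 * ((\<Prod>i\<in>A. x i) * (\<Prod>i\<in>{..<M} - A. x (Suc i))) = (\<Prod>v<Suc M. x v ^ visits A v)"
    if A: "A \<subseteq> {..<M}" for A
  proof -
    have "(\<Prod>v<Suc M. x v ^ (if v \<in> A then 1 else 0)) = (\<Prod>v\<in>A. x v)"
      by (rule prod.mono_neutral_cong_right) (use A in auto)
    moreover have "(\<Prod>i<M. x (Suc i) ^ (if i \<notin> A then 1 else 0)) = (\<Prod>i\<in>{..<M} - A. x (Suc i))"
      by (rule prod.mono_neutral_cong_right) (use A in auto)
    then have "(\<Prod>v<Suc M. x v ^ (if v = 0 \<or> v - 1 \<notin> A then 1 else 0)) = x 0 * (\<Prod>i\<in>{..<M} - A. x (Suc i))"
      by (subst prod.lessThan_Suc_shift) simp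
    ultimately show ?thesis
      unfolding visits_def by (simp only: power_add prod.distrib mult_ac)
  qed
  then show ?thesis
    unfolding prod_add[OF finite_lessThan] sum_distrib_left by (intro sum.cong refl) blast
qed

lemma prod_by_fibres:
  fixes f :: "'v \<Rightarrow> 'r::comm_monoid_mult"
  assumes "finite V" "finite I" "b ` V \<subseteq> I"
  shows "(\<Prod>v\<in>V. f v) = (\<Prod>i\<in>I. \<Prod>v\<in>{v\<in>V. b v = i}. f v)"
  using prod.group[OF assms, of f] by simp

text \<open>Equal colors add to 0 in characteristic 2, so a coloring that is not proper on the path
  contributes 0. The sum over the colorings that are rainbow on the triples is an odd count, hence
  nonzero, and some such coloring is proper.\<close>

theorem path_plus_triples:
  fixes b :: "nat \<Rightarrow> 'i"
  assumes fin: "finite I" and b: "\<And>v. v < N \<Longrightarrow> b v \<in> I"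
    and card3: "\<And>i. i \<in> I \<Longrightarrow> card {v. v < N \<and> b v = i} = 3"
  obtains c :: "nat \<Rightarrow> nat" where "\<And>v. c v < 3"
    and "\<And>v. Suc v < N \<Longrightarrow> c v \<noteq> c (Suc v)"
    and "\<And>u v. u < N \<Longrightarrow> v < N \<Longrightarrow> u \<noteq> v \<Longrightarrow> b u = b v \<Longrightarrow> c u \<noteq> c v"
proof (cases N)
  case 0
  then show ?thesis using that[of "\<lambda>_. 0"] by auto
next
  case (Suc M)
  define B where "B i = {v. v < N \<and> b v = i}" for i
  define C :: "(nat \<times> nat) set" where "C = {1, 2} \<times> {0, 1, 2}"
  \<comment> \<open>The permutations of three colors are the affine maps modulo 3, indexed by \<open>C\<close>.\<close>
  have "\<exists>k. bij_betw k (B i) {0, 1, 2::nat}" if "i \<in> I" for i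
    using card3[OF that] by (intro finite_same_card_bij) (auto simp: B_def)
  then obtain k where k: "\<And>i. i \<in> I \<Longrightarrow> bij_betw (k i) (B i) {0, 1, 2::nat}"
    by metis
  \<comment> \<open>Colors are exponents of \<open>omega\<close>: \<open>k\<close> labels the
    vertices of each triple by 0, 1, 2, and \<open>\<chi>\<close> chooses an affine map for the
    triple.\<close>
  define col where "col \<chi> v = fst (\<chi> (b v)) * k (b v) v + snd (\<chi> (b v))"
    for v and \<chi> :: "'i \<Rightarrow> nat \<times> nat"
  define h where "h A i ab = (\<Prod>v\<in>B i. (omega ^ (fst ab * k i v + snd ab)) ^ visits A v)"
    for A i and ab :: "nat \<times> nat"
  have h: "(\<Sum>ab\<in>C. h A i ab) = of_bool (visits A ` B i = {0, 1, 2})" if i: "i \<in> I" for A i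
  proof -
    define g where "g = inv_into (B i) (k i)"
    have g: "bij_betw g {0, 1, 2} (B i)" unfolding g_def by (rule bij_betw_inv_into[OF k[OF i]])
    have kg: "k i (g x) = x" if "x \<in> {0, 1, 2}" for x
      unfolding g_def using bij_betw_inv_into_right[OF k[OF i] that] .
    have gB: "g ` {0, 1, 2} = B i" and gi: "inj_on g {0, 1, 2}" using g by (auto simp: bij_betw_def)
    have "h A i ab = (\<Prod>x\<in>{0, 1, 2}. (omega ^ (fst ab * x + snd ab)) ^ visits A (g x))" for ab
      unfolding h_def gB[symmetric] prod.reindex[OF gi] o_def
      by (intro prod.cong refl) (simp only: kg)
    also have "(\<Prod>x\<in>{0, 1, 2}. f x) = f 0 * f 1 * f 2" for f :: "nat \<Rightarrow> gf4"
      by (simp add: mult.assoc)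
    finally have "(\<Sum>ab\<in>C. h A i ab) = (\<Sum>(\<alpha>, \<beta>)\<in>{1, 2} \<times> {0, 1, 2}. (omega ^ \<beta>) ^ visits A (g 0)
        * (omega ^ (\<alpha> + \<beta>)) ^ visits A (g 1) * (omega ^ (2 * \<alpha> + \<beta>)) ^ visits A (g 2))"
      unfolding C_def case_prod_unfold
      by (simp only: mult_0_right mult_1_right add_0_left mult.commute[of _ 2])
    also have "\<dots> = of_bool ({visits A (g 0), visits A (g 1), visits A (g 2)} = {0, 1, 2})"
      by (rule sum_affine_omega) (auto simp: visits_def)
    also have "{visits A (g 0), visits A (g 1), visits A (g 2)} = visits A ` B i"
      unfolding gB[symmetric] by simp
    finally show ?thesis .
  qed
  have "(\<Sum>\<chi>\<in>PiE I (\<lambda>_. C). omega ^ col \<chi> 0 * (\<Prod>i<M. omega ^ col \<chi> i + omega ^ col \<chi> (Suc i)))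
      = (\<Sum>\<chi>\<in>PiE I (\<lambda>_. C). \<Sum>A\<in>Pow {..<M}. \<Prod>v<Suc M. (omega ^ col \<chi> v) ^ visits A v)"
    by (intro sum.cong refl prod_path_expand)
  also have "\<dots> = (\<Sum>\<chi>\<in>PiE I (\<lambda>_. C). \<Sum>A\<in>Pow {..<M}. \<Prod>i\<in>I. h A i (\<chi> i))"
  proof (intro sum.cong refl)
    fix \<chi> :: "'i \<Rightarrow> nat \<times> nat" and A
    have "(\<Prod>v<Suc M. (omega ^ col \<chi> v) ^ visits A v)
        = (\<Prod>i\<in>I. \<Prod>v\<in>{v\<in>{..<Suc M}. b v = i}. (omega ^ col \<chi> v) ^ visits A v)"
      by (rule prod_by_fibres) (use fin b Suc in auto)
    also have "\<dots> = (\<Prod>i\<in>I. h A i (\<chi> i))"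
      unfolding h_def by (intro prod.cong refl) (auto simp: B_def Suc col_def)
    finally show "(\<Prod>v<Suc M. (omega ^ col \<chi> v) ^ visits A v) = (\<Prod>i\<in>I. h A i (\<chi> i))" .
  qed
  also have "\<dots> = (\<Sum>A\<in>Pow {..<M}. \<Sum>\<chi>\<in>PiE I (\<lambda>_. C). \<Prod>i\<in>I. h A i (\<chi> i))"
    by (rule sum.swap)
  \<comment> \<open>The maps on different triples are chosen independently, so the sum factors into
    the local sums evaluated by \<open>h\<close>.\<close>
  also have "\<dots> = (\<Sum>A\<in>Pow {..<M}. \<Prod>i\<in>I. \<Sum>ab\<in>C. h A i ab)"
    by (intro sum.cong refl prod_sum_PiE[symmetric]) (auto simp: fin C_def)
  also have "\<dots> = (\<Sum>A\<in>Pow {..<M}. of_bool (\<forall>i\<in>I. visits A ` B i = {0, 1, 2}))"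
  proof (intro sum.cong refl)
    fix A
    have "(\<Prod>i\<in>I. \<Sum>ab\<in>C. h A i ab) = (\<Prod>i\<in>I. of_bool (visits A ` B i = {0, 1, 2}))"
      by (intro prod.cong refl h)
    also have "\<dots> = of_bool (\<forall>i\<in>I. visits A ` B i = {0, 1, 2})"
      using fin by (induction rule: finite_induct) auto
    finally show "(\<Prod>i\<in>I. \<Sum>ab\<in>C. h A i ab) = of_bool (\<forall>i\<in>I. visits A ` B i = {0, 1, 2})" .
  qed
  also have "\<dots> = of_nat (card {A \<in> Pow {..<M}. \<forall>i\<in>I. visits A ` B i = {0, 1, 2}})"
    by (subst sum_of_bool_eq) (auto simp: Int_def conj_commute)
  also have "\<dots> = (1 :: gf4)"
    using odd_card_rainbow_visits[OF fin b card3 Suc] unfolding B_def[symmetric]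
    by (simp only: gf4_of_nat of_bool_eq not_False_eq_True)
  finally have "(\<Sum>\<chi>\<in>PiE I (\<lambda>_. C). omega ^ col \<chi> 0 * (\<Prod>i<M. omega ^ col \<chi> i + omega ^ col \<chi> (Suc i))) \<noteq> 0"
    by simp
  then obtain \<chi> where \<chi>: "\<chi> \<in> PiE I (\<lambda>_. C)"
    and nz: "omega ^ col \<chi> 0 * (\<Prod>i<M. omega ^ col \<chi> i + omega ^ col \<chi> (Suc i)) \<noteq> 0"
    by (rule sum.not_neutral_contains_not_neutral)
  show ?thesis
  proof (rule that[of "\<lambda>v. col \<chi> v mod 3"])
    fix v assume "Suc v < N"
    then have v: "v \<in> {..<M}" using Suc by simp
    have "omega ^ col \<chi> v + omega ^ col \<chi> (Suc v) \<noteq> 0"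
    proof
      assume "omega ^ col \<chi> v + omega ^ col \<chi> (Suc v) = 0"
      then have "(\<Prod>i<M. omega ^ col \<chi> i + omega ^ col \<chi> (Suc i)) = 0"
        using v by (intro prod_zero) auto
      then show False using nz by simp
    qed
    moreover have "omega ^ col \<chi> v = omega ^ col \<chi> (Suc v)"
      if "col \<chi> v mod 3 = col \<chi> (Suc v) mod 3"
      unfolding omega_power[of "col \<chi> v"] omega_power[of "col \<chi> (Suc v)"] using that by simp
    ultimately show "col \<chi> v mod 3 \<noteq> col \<chi> (Suc v) mod 3"
      using gf4_add_self[of "omega ^ col \<chi> (Suc v)"] by auto
  next
    fix u v assume uv: "u < N" "v < N" "u \<noteq> v" "b u = b v"
    obtain \<alpha> \<beta> where ab: "\<chi> (b v) = (\<alpha>, \<beta>)" "\<alpha> = 1 \<or> \<alpha> = 2"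
      using \<chi> b[OF uv(2)] by (cases "\<chi> (b v)") (auto simp: C_def PiE_iff)
    have "u \<in> B (b v)" "v \<in> B (b v)" using uv by (auto simp: B_def)
    then have "k (b v) u \<in> {0, 1, 2}" "k (b v) v \<in> {0, 1, 2}" "k (b v) u \<noteq> k (b v) v"
      using bij_betw_apply[OF k[OF b[OF uv(2)]]] inj_onD[OF bij_betw_imp_inj_on[OF k[OF b[OF uv(2)]]], of u v] uv(3)
      by blast+
    then have lt: "k (b v) u < 3" "k (b v) v < 3" "k (b v) u < k (b v) v \<or> k (b v) v < k (b v) u"
      by (simp_all add: neq_iff) linarith+
    from lt(3) show "col \<chi> u mod 3 \<noteq> col \<chi> v mod 3"
      unfolding col_def uv(4) ab(1) fst_conv snd_conv
    proof
      assume "k (b v) u < k (b v) v"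
      then show "(\<alpha> * k (b v) u + \<beta>) mod 3 \<noteq> (\<alpha> * k (b v) v + \<beta>) mod 3"
        using affine_mod_3_neq lt ab(2) by blast
    next
      assume "k (b v) v < k (b v) u"
      then show "(\<alpha> * k (b v) u + \<beta>) mod 3 \<noteq> (\<alpha> * k (b v) v + \<beta>) mod 3"
        by (rule affine_mod_3_neq[OF _ lt(1) ab(2), THEN not_sym])
    qed
  qed auto
qed

section \<open>From a path with triples to a linear forest with blocks of size at most 3\<close>

lemma card_eq_sum_fibres:
  assumes "finite A" "finite I" "b ` A \<subseteq> I"
  shows "card A = (\<Sum>i\<in>I. card {v\<in>A. b v = i})"
  using sum.group[OF assms, of "\<lambda>_. 1 :: nat"] by simp

text \<open>Greedy filling: the free places number exactly \<open>card D\<close>, so each new point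
  finds a fibre with room. Once \<open>D\<close> is used up, the total forces every fibre to be
  full.\<close>

lemma extend_to_uniform_fibres:
  fixes b :: "'v \<Rightarrow> 'i"
  assumes "finite D" "finite A" "A \<inter> D = {}" "finite I" "b ` A \<subseteq> I"
    and "\<And>i. i \<in> I \<Longrightarrow> card {v\<in>A. b v = i} \<le> k" "card A + card D = k * card I"
  shows "\<exists>b'. (\<forall>v\<in>A. b' v = b v) \<and> b' ` (A \<union> D) \<subseteq> I \<and> (\<forall>i\<in>I. card {v\<in>A \<union> D. b' v = i} = k)"
  using assms
proof (induction D arbitrary: A b rule: finite_induct)
  case empty
  have sum: "(\<Sum>i\<in>I. card {v\<in>A. b v = i}) = (\<Sum>i\<in>I. k)"
    using card_eq_sum_fibres[OF empty(1,3,4)] empty(6) by simp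
  have "card {v\<in>A. b v = i} = k" if "i \<in> I" for i
    using sum_mono_inv[OF sum _ that] empty(3,5) by auto
  then show ?case using empty by (intro exI[of _ b]) auto
next
  case (insert d D)
  have "\<exists>i\<in>I. card {v\<in>A. b v = i} < k"
  proof (rule ccontr)
    assume "\<not> ?thesis"
    then have "(\<Sum>i\<in>I. k) \<le> (\<Sum>i\<in>I. card {v\<in>A. b v = i})"
      by (intro sum_mono) (auto simp: not_less)
    also have "\<dots> = card A" 
      by (rule card_eq_sum_fibres[OF insert.prems(1,3,4), symmetric])
    finally show False using insert.prems(6) insert.hyps by (simp add: mult.commute)
  qed
  then obtain i where i: "i \<in> I" "card {v\<in>A. b v = i} < k" by auto
  have d: "d \<notin> A" using insert by auto
  have fibre: "{v\<in>insert d A. (b(d := i)) v = j}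
      = (if j = i then insert d {v\<in>A. b v = i} else {v\<in>A. b v = j})" for j
    using d by auto
  have "\<exists>b'. (\<forall>v\<in>insert d A. b' v = (b(d := i)) v) \<and> b' ` (insert d A \<union> D) \<subseteq> I
      \<and> (\<forall>i\<in>I. card {v\<in>insert d A \<union> D. b' v = i} = k)"
  proof (rule insert.IH)
    show "card {v\<in>insert d A. (b(d := i)) v = j} \<le> k" if "j \<in> I" for j
      unfolding fibre using insert.prems(5)[OF that] i insert.prems(1) d by auto
  qed (use insert i d in auto)
  then obtain b' where "\<forall>v\<in>insert d A. b' v = (b(d := i)) v" "b' ` (insert d A \<union> D) \<subseteq> I"
    "\<forall>i\<in>I. card {v\<in>insert d A \<union> D. b' v = i} = k" by blast
  moreover from this(1) have "\<forall>v\<in>A. b' v = b v" using d by (metis fun_upd_other insertCI)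
  ultimately show ?case by (intro exI[of _ b']) auto
qed

text \<open>The path is prolonged by new vertices at its end, which fill every block up to exactly
  three.\<close>

lemma path_plus_small_blocks:
  fixes b :: "nat \<Rightarrow> 'i"
  assumes le3: "\<And>i. card {v. v < m \<and> b v = i} \<le> 3"
  obtains c :: "nat \<Rightarrow> nat" where "\<And>v. c v < 3"
    and "\<And>v. Suc v < m \<Longrightarrow> c v \<noteq> c (Suc v)"
    and "\<And>u v. u < m \<Longrightarrow> v < m \<Longrightarrow> u \<noteq> v \<Longrightarrow> b u = b v \<Longrightarrow> c u \<noteq> c v"
proof -
  define I where "I = b ` {..<m}"
  define N where "N = 3 * card I"
  have "m = (\<Sum>i\<in>I. card {v\<in>{..<m}. b v = i})"
    using card_eq_sum_fibres[of "{..<m}" I b] by (simp add: I_def)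
  also have "\<dots> \<le> (\<Sum>i\<in>I. 3)" using le3 by (intro sum_mono) simp
  finally have mN: "m \<le> N" by (simp add: N_def)
  then have un: "{..<m} \<union> {m..<N} = {..<N}" by auto
  have "\<exists>b'. (\<forall>v\<in>{..<m}. b' v = b v) \<and> b' ` ({..<m} \<union> {m..<N}) \<subseteq> I
      \<and> (\<forall>i\<in>I. card {v\<in>{..<m} \<union> {m..<N}. b' v = i} = 3)"
    by (rule extend_to_uniform_fibres) (use le3 mN in \<open>auto simp: I_def N_def\<close>)
  then obtain b' where b': "\<forall>v\<in>{..<m}. b' v = b v" "b' ` {..<N} \<subseteq> I"
    "\<forall>i\<in>I. card {v\<in>{..<N}. b' v = i} = 3"
    unfolding un by (elim exE conjE)
  have bI: "b' v \<in> I" if "v < N" for v using b'(2) that by blast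
  have card3: "card {v. v < N \<and> b' v = i} = 3" if "i \<in> I" for i using b'(3) that by simp
  have finI: "finite I" by (simp add: I_def)
  show ?thesis
  proof (rule path_plus_triples[of I N b', OF finI bI card3])
    fix c :: "nat \<Rightarrow> nat"
    assume c: "\<And>v. c v < 3" "\<And>v. Suc v < N \<Longrightarrow> c v \<noteq> c (Suc v)"
      "\<And>u v. u < N \<Longrightarrow> v < N \<Longrightarrow> u \<noteq> v \<Longrightarrow> b' u = b' v \<Longrightarrow> c u \<noteq> c v"
    show thesis
    proof (rule that[of c])
      show "c v \<noteq> c (Suc v)" if "Suc v < m" for v using c(2) that mN by simp
      show "c u \<noteq> c v" if "u < m" "v < m" "u \<noteq> v" "b u = b v" for u v
        using c(3)[of u v] b'(1) that mN by simp
    qed (rule c(1))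
  qed
qed

text \<open>A vertex of degree at most 1 starts the list; its neighbour, if there is one, has degree at
  most 1 in the rest and is put next.\<close>

lemma linear_forest_order:
  assumes "finite V" "\<And>x y. E x y \<Longrightarrow> E y x" "\<And>x. \<not> E x x"
    and "\<And>v. v \<in> V \<Longrightarrow> card {w\<in>V. E v w} \<le> 2"
    and "\<And>S. S \<subseteq> V \<Longrightarrow> S \<noteq> {} \<Longrightarrow> \<exists>v\<in>S. card {w\<in>S. E v w} \<le> 1"
    and "u \<in> V" "card {w\<in>V. E u w} \<le> 1"
  shows "\<exists>xs. distinct (u # xs) \<and> set (u # xs) = V
    \<and> (\<forall>x\<in>V. \<forall>y\<in>V. E x y \<longrightarrow> (\<exists>i. Suc i < length (u # xs) \<and> {x, y} = {(u # xs) ! i, (u # xs) ! Suc i}))"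
  using assms
proof (induction "card V" arbitrary: V u)
  case 0
  then show ?case by auto
next
  case (Suc n)
  note fin = Suc.prems(1) and symE = Suc.prems(2) and irr = Suc.prems(3) and deg = Suc.prems(4)
    and acyc = Suc.prems(5) and u = Suc.prems(6,7)
  define V' where "V' = V - {u}"
  have V: "V = insert u V'" "u \<notin> V'" "finite V'" using u fin by (auto simp: V'_def)
  show ?case
  proof (cases "V' = {}")
    case True
    then have "V = {u}" using V by simp
    then show ?thesis using irr by (intro exI[of _ "[]"]) auto
  next
    case False
    have "\<exists>u'\<in>V'. card {w\<in>V'. E u' w} \<le> 1 \<and> (\<forall>w\<in>V'. E u w \<longrightarrow> w = u')"
    proof (cases "\<exists>w\<in>V'. E u w")
      case True
      then obtain w where w: "w \<in> V'" "E u w" by auto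
      have fw: "finite {x\<in>V. E u x}" using fin by auto
      have "x = w" if "x \<in> V'" "E u x" for x
      proof -
        have "x \<in> {x\<in>V. E u x}" "w \<in> {x\<in>V. E u x}" using that w V(1) by auto
        moreover have "\<forall>a\<in>{x\<in>V. E u x}. \<forall>b\<in>{x\<in>V. E u x}. a = b"
          using u(2) card_le_Suc0_iff_eq[OF fw] by (simp only: One_nat_def)
        ultimately show ?thesis by blast
      qed
      moreover have "card {x\<in>V'. E w x} \<le> 1"
      proof -
        have "{x\<in>V. E w x} = insert u {x\<in>V'. E w x}" using symE[OF w(2)] V(1) by auto
        then have "card {x\<in>V. E w x} = Suc (card {x\<in>V'. E w x})" using V by simp
        then show ?thesis using deg[of w] w V(1) by auto
      qed
      ultimately show ?thesis using w by blast
    next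
      case False
      \<comment> \<open>Consecutive list entries need not be adjacent, so the list may jump to any
        vertex of degree at most 1 in the rest.\<close>
      then show ?thesis using acyc[of V'] \<open>V' \<noteq> {}\<close> V(1) by blast
    qed
    then obtain u' where u': "u' \<in> V'" "card {w\<in>V'. E u' w} \<le> 1" "\<And>w. w \<in> V' \<Longrightarrow> E u w \<Longrightarrow> w = u'"
      by blast
    have "\<exists>xs. distinct (u' # xs) \<and> set (u' # xs) = V'
      \<and> (\<forall>x\<in>V'. \<forall>y\<in>V'. E x y \<longrightarrow> (\<exists>i. Suc i < length (u' # xs) \<and> {x, y} = {(u' # xs) ! i, (u' # xs) ! Suc i}))"
    proof (rule Suc.hyps(1))
      show "n = card V'" using Suc.hyps(2) V by simp
      show "card {w\<in>V'. E v w} \<le> 2" if "v \<in> V'" for v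
      proof -
        have "card {w\<in>V'. E v w} \<le> card {w\<in>V. E v w}"
          by (rule card_mono) (use fin V(1) in auto)
        then show ?thesis using deg[of v] that V(1) by auto
      qed
      show "\<exists>v\<in>S. card {w\<in>S. E v w} \<le> 1" if "S \<subseteq> V'" "S \<noteq> {}" for S
        using acyc[of S] that V(1) by auto
    qed (use V(3) symE irr u'(1,2) in blast)+
    then obtain xs where xs: "distinct (u' # xs)" "set (u' # xs) = V'"
      "\<And>x y. x \<in> V' \<Longrightarrow> y \<in> V' \<Longrightarrow> E x y \<Longrightarrow>
        \<exists>i. Suc i < length (u' # xs) \<and> {x, y} = {(u' # xs) ! i, (u' # xs) ! Suc i}"
      by blast
    have "\<exists>i. Suc i < length (u # u' # xs) \<and> {x, y} = {(u # u' # xs) ! i, (u # u' # xs) ! Suc i}"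
      if xy: "x \<in> V" "y \<in> V" "E x y" for x y
    proof (cases "x = u \<or> y = u")
      case True
      have "x \<noteq> y" using irr xy by auto
      then have "{x, y} = {u, u'}"
        using True xy V(1) u'(3)[of x] u'(3)[of y] symE[OF xy(3)] by blast
      then show ?thesis by (intro exI[of _ 0]) simp
    next
      case False
      then obtain i where "Suc i < length (u' # xs)" "{x, y} = {(u' # xs) ! i, (u' # xs) ! Suc i}"
        using xs(3)[of x y] xy V(1) by auto
      then show ?thesis by (intro exI[of _ "Suc i"]) simp
    qed
    then show ?thesis
      using xs(1,2) V by (intro exI[of _ "u' # xs"]) auto
  qed
qed

text \<open>The assumption \<open>acyc\<close> expresses that there is no cycle. All edges then join
  consecutive entries of a list of the vertices, and it suffices to color the positions.\<close>

theorem linear_forest_plus_triples: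
  fixes b :: "'a \<Rightarrow> 'i"
  assumes fin: "finite V" and sym: "\<And>x y. E x y \<Longrightarrow> E y x" and irr: "\<And>x. \<not> E x x"
    and deg: "\<And>v. v \<in> V \<Longrightarrow> card {w\<in>V. E v w} \<le> 2"
    and acyc: "\<And>S. S \<subseteq> V \<Longrightarrow> S \<noteq> {} \<Longrightarrow> \<exists>v\<in>S. card {w\<in>S. E v w} \<le> 1"
    and le3: "\<And>i. card {v\<in>V. b v = i} \<le> 3"
  obtains c :: "'a \<Rightarrow> nat" where "\<And>v. c v < 3"
    and "\<And>x y. x \<in> V \<Longrightarrow> y \<in> V \<Longrightarrow> E x y \<Longrightarrow> c x \<noteq> c y"
    and "\<And>x y. x \<in> V \<Longrightarrow> y \<in> V \<Longrightarrow> x \<noteq> y \<Longrightarrow> b x = b y \<Longrightarrow> c x \<noteq> c y"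
proof (cases "V = {}")
  case True
  then show ?thesis using that[of "\<lambda>_. 0"] by auto
next
  case False
  then obtain u where u: "u \<in> V" "card {w\<in>V. E u w} \<le> 1" using acyc[of V] by auto
  obtain xs where xs: "distinct xs" "set xs = V"
    "\<And>x y. x \<in> V \<Longrightarrow> y \<in> V \<Longrightarrow> E x y \<Longrightarrow> \<exists>i. Suc i < length xs \<and> {x, y} = {xs ! i, xs ! Suc i}"
    using linear_forest_order[OF fin sym irr deg acyc u] by blast
  define m where "m = length xs"
  have bij: "bij_betw ((!) xs) {..<m} V" using bij_betw_nth[OF xs(1)] xs(2) by (simp add: m_def)
  define pos where "pos = inv_into {..<m} ((!) xs)"
  have pos: "pos x < m" "xs ! pos x = x" if "x \<in> V" for x
    using bij_betw_apply[OF bij_betw_inv_into[OF bij] that] bij_betw_inv_into_right[OF bij that]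
    by (auto simp: pos_def)
  have pos_nth: "pos (xs ! i) = i" if "i < m" for i
    using bij_betw_inv_into_left[OF bij] that by (simp add: pos_def)
  have "card {v. v < m \<and> b (xs ! v) = i} \<le> 3" for i
  proof -
    have "card {v. v < m \<and> b (xs ! v) = i} \<le> card {v\<in>V. b v = i}"
      by (rule card_inj_on_le[where f = "(!) xs"])
        (use bij fin in \<open>auto simp: bij_betw_def inj_on_def\<close>)
    then show ?thesis using le3[of i] by linarith
  qed
  then obtain c :: "nat \<Rightarrow> nat" where c: "\<And>v. c v < 3" "\<And>v. Suc v < m \<Longrightarrow> c v \<noteq> c (Suc v)"
    "\<And>u v. u < m \<Longrightarrow> v < m \<Longrightarrow> u \<noteq> v \<Longrightarrow> b (xs ! u) = b (xs ! v) \<Longrightarrow> c u \<noteq> c v"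
    using path_plus_small_blocks[of m "\<lambda>i. b (xs ! i)"] by blast
  show ?thesis
  proof (rule that[of "\<lambda>x. c (pos x)"])
    fix x y assume "x \<in> V" "y \<in> V" "E x y"
    then obtain i where i: "Suc i < m" "{x, y} = {xs ! i, xs ! Suc i}"
      using xs(3)[of x y] unfolding m_def by blast
    then show "c (pos x) \<noteq> c (pos y)"
      using c(2)[OF i(1)] pos_nth[of i] pos_nth[of "Suc i"] by (auto simp: doubleton_eq_iff)
  next
    fix x y assume "x \<in> V" "y \<in> V" "x \<noteq> y" "b x = b y"
    then show "c (pos x) \<noteq> c (pos y)" using c(3)[of "pos x" "pos y"] pos by metis
  qed (rule c(1))
qed

section \<open>Transversals of cycles and blocks\<close>

text \<open>The induction of Halmos and Vaughan. If a proper nonempty subfamily is tight, it and the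
  rest are matched separately; otherwise any single choice leaves Hall's condition intact.\<close>

lemma hall:
  assumes "finite I" "\<And>i. i \<in> I \<Longrightarrow> finite (N i)"
    and "\<And>J. J \<subseteq> I \<Longrightarrow> card J \<le> card (\<Union>i\<in>J. N i)"
  shows "\<exists>f. inj_on f I \<and> (\<forall>i\<in>I. f i \<in> N i)"
  using assms
proof (induction "card I" arbitrary: I N rule: less_induct)
  case less
  note finI = less.prems(1) and finN = less.prems(2) and hall = less.prems(3)
  have finUN: "finite (\<Union>i\<in>J. N i)" if "J \<subseteq> I" for J
    using that finI finN by (auto intro: finite_subset)
  show ?case
  proof (cases "I = {}")
    case True
    then show ?thesis by auto
  next
    case False
    show ?thesis
    proof (cases "\<exists>J. J \<subset> I \<and> J \<noteq> {} \<and> card (\<Union>i\<in>J. N i) = card J")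
      case True
      then obtain J where J: "J \<subset> I" "J \<noteq> {}" "card (\<Union>i\<in>J. N i) = card J" by auto
      define U where "U = (\<Union>i\<in>J. N i)"
      have finJ: "finite J" using J(1) finI by (meson finite_subset psubset_imp_subset)
      have finU: "finite U" unfolding U_def using finUN J(1) by auto
      have "\<exists>f. inj_on f J \<and> (\<forall>i\<in>J. f i \<in> N i)"
        using J(1) finI finN hall by (intro less.hyps) (auto simp: psubset_card_mono finJ)
      then obtain f where f: "inj_on f J" "\<And>i. i \<in> J \<Longrightarrow> f i \<in> N i" by blast
      have "\<exists>g. inj_on g (I - J) \<and> (\<forall>i\<in>I - J. g i \<in> N i - U)"
      proof (rule less.hyps)
        show "card (I - J) < card I" using J finI by (intro psubset_card_mono) auto
        show "card K \<le> card (\<Union>i\<in>K. N i - U)" if K: "K \<subseteq> I - J" for K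
        proof -
          have "finite K" using K finI by (auto intro: finite_subset)
          have "card K + card J = card (K \<union> J)"
            using K \<open>finite K\<close> finJ by (intro card_Un_disjoint[symmetric]) auto
          also have "\<dots> \<le> card (\<Union>i\<in>K \<union> J. N i)" using K J by (intro hall) auto
          also have "(\<Union>i\<in>K \<union> J. N i) = (\<Union>i\<in>K. N i - U) \<union> U" by (auto simp: U_def)
          also have "card \<dots> \<le> card (\<Union>i\<in>K. N i - U) + card U" by (rule card_Un_le)
          finally show ?thesis using J(3) by (simp add: U_def)
        qed
      qed (use finI finN in auto)
      then obtain g where g: "inj_on g (I - J)" "\<And>i. i \<in> I - J \<Longrightarrow> g i \<in> N i - U" by blast
      define h where "h i = (if i \<in> J then f i else g i)" for i
      have fU: "f i \<in> U" if "i \<in> J" for i using f(2)[OF that] that by (auto simp: U_def)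
      have "inj_on h I"
      proof (rule inj_onI)
        fix x y assume xy: "x \<in> I" "y \<in> I" "h x = h y"
        show "x = y"
        proof (cases "x \<in> J"; cases "y \<in> J")
          assume "x \<in> J" "y \<in> J"
          then show ?thesis using xy f(1) by (simp add: h_def inj_on_def)
        next
          assume "x \<in> J" "y \<notin> J"
          then show ?thesis using xy fU[of x] g(2)[of y] by (simp add: h_def)
        next
          assume "x \<notin> J" "y \<in> J"
          then show ?thesis using xy fU[of y] g(2)[of x] by (simp add: h_def)
        next
          assume "x \<notin> J" "y \<notin> J"
          then show ?thesis using xy g(1) by (simp add: h_def inj_on_def)
        qed
      qed
      moreover have "\<forall>i\<in>I. h i \<in> N i" using f(2) g(2) by (simp add: h_def)
      ultimately show ?thesis by blast
    next
      case no_tight: False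
      obtain i where i: "i \<in> I" using False by auto
      have "card {i} \<le> card (\<Union>j\<in>{i}. N j)" using i by (intro hall) auto
      then have "N i \<noteq> {}" by auto
      then obtain x where x: "x \<in> N i" by auto
      have "\<exists>g. inj_on g (I - {i}) \<and> (\<forall>j\<in>I - {i}. g j \<in> N j - {x})"
      proof (rule less.hyps)
        show "card (I - {i}) < card I" using i finI by (intro psubset_card_mono) auto
        show "card K \<le> card (\<Union>j\<in>K. N j - {x})" if K: "K \<subseteq> I - {i}" for K
        proof (cases "K = {}")
          case False
          have "K \<subset> I" using K i by auto
          then have "card (\<Union>j\<in>K. N j) \<noteq> card K" using no_tight False by blast
          moreover have "card K \<le> card (\<Union>j\<in>K. N j)" using \<open>K \<subset> I\<close> by (intro hall) auto
          moreover have "card (\<Union>j\<in>K. N j) - 1 \<le> card ((\<Union>j\<in>K. N j) - {x})"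
            by (simp add: card_Diff_singleton_if)
          moreover have "(\<Union>j\<in>K. N j - {x}) = (\<Union>j\<in>K. N j) - {x}" by auto
          ultimately show ?thesis by simp
        qed simp
      qed (use finI finN in auto)
      then obtain g where g: "inj_on g (I - {i})" "\<And>j. j \<in> I - {i} \<Longrightarrow> g j \<in> N j - {x}" by blast
      have "inj_on (g(i := x)) I"
      proof (rule inj_onI)
        fix y z assume "y \<in> I" "z \<in> I" "(g(i := x)) y = (g(i := x)) z"
        then show "y = z"
          using g(2)[of y] g(2)[of z] inj_onD[OF g(1), of y z]
          by (cases "y = i"; cases "z = i") auto
      qed
      moreover have "\<forall>j\<in>I. (g(i := x)) j \<in> N j" using g(2) x by simp
      ultimately show ?thesis by blast
    qed
  qed
qed

lemma card_le_fibres: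
  assumes "finite A" "\<And>i. card {v\<in>A. b v = i} \<le> k"
  shows "card A \<le> k * card (b ` A)"
proof -
  have "card A = (\<Sum>i\<in>b ` A. card {v\<in>A. b v = i})"
    using assms(1) by (intro card_eq_sum_fibres) auto
  also have "\<dots> \<le> (\<Sum>i\<in>b ` A. k)" by (intro sum_mono assms(2))
  finally show ?thesis by (simp add: mult.commute)
qed

text \<open>Hall's theorem is applied after adding \<open>t div 4\<close> dummy blocks available to
  every cycle; \<open>U\<close> collects the cycles matched to dummies. Adding 1 to the length of
  each triangle makes every cycle count at least 4, while a block holds at most 4 vertices, so the
  shortage is at most \<open>t div 4\<close>.\<close>

lemma partial_representatives:
  fixes \<C> :: "'a set set" and b :: "'a \<Rightarrow> 'i"
  assumes fin: "finite \<C>" and finC: "\<And>C. C \<in> \<C> \<Longrightarrow> finite C"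
    and disj: "\<And>C D. C \<in> \<C> \<Longrightarrow> D \<in> \<C> \<Longrightarrow> C \<noteq> D \<Longrightarrow> C \<inter> D = {}"
    and ge3: "\<And>C. C \<in> \<C> \<Longrightarrow> 3 \<le> card C"
    and le4: "\<And>i. card {v\<in>\<Union>\<C>. b v = i} \<le> 4"
  shows "\<exists>U X. U \<subseteq> \<C> \<and> 4 * card U \<le> card {C\<in>\<C>. card C = 3}
    \<and> (\<forall>C\<in>\<C> - U. X C \<in> C) \<and> inj_on (\<lambda>C. b (X C)) (\<C> - U)"
proof -
  define t where "t = card {C\<in>\<C>. card C = 3}"
  define N :: "'a set \<Rightarrow> ('i + nat) set" where "N C = Inl ` b ` C \<union> Inr ` {..<t div 4}" for C
  have "\<exists>f. inj_on f \<C> \<and> (\<forall>C\<in>\<C>. f C \<in> N C)"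
  proof (rule hall[OF fin])
    show "finite (N C)" if "C \<in> \<C>" for C using finC[OF that] by (simp add: N_def)
    fix J assume J: "J \<subseteq> \<C>"
    show "card J \<le> card (\<Union>C\<in>J. N C)"
    proof (cases "J = {}")
      case False
      have finJ: "finite J" using J fin by (rule finite_subset)
      have finUJ: "finite (\<Union>J)" using finJ J finC by auto
      have "4 * card J \<le> (\<Sum>C\<in>J. card C + of_bool (card C = 3))"
      proof -
        have "4 \<le> card C + of_bool (card C = 3)" if "C \<in> J" for C
          using ge3[of C] J that by (cases "card C = 3") auto
        then have "(\<Sum>C\<in>J. 4) \<le> (\<Sum>C\<in>J. card C + of_bool (card C = 3))" by (intro sum_mono)
        then show ?thesis by simp
      qed
      also have "\<dots> = (\<Sum>C\<in>J. card C) + card {C\<in>J. card C = 3}"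
        using finJ by (simp add: sum.distrib sum_of_bool_eq Int_def)
      finally have count: "4 * card J \<le> (\<Sum>C\<in>J. card C) + card {C\<in>J. card C = 3}" .
      have "(\<Sum>C\<in>J. card C) = card (\<Union>J)"
      proof (rule card_Union_disjoint[symmetric])
        show "pairwise disjnt J" unfolding pairwise_def disjnt_def using disj J by blast
        show "finite C" if "C \<in> J" for C using finC J that by blast
      qed
      moreover have "card {C\<in>J. card C = 3} \<le> t"
        unfolding t_def by (rule card_mono) (use fin J in auto)
      moreover have "card (\<Union>J) \<le> 4 * card (b ` \<Union>J)"
      proof (rule card_le_fibres[OF finUJ])
        fix i
        have "finite (\<Union>\<C>)" using fin finC by auto
        then have "card {v\<in>\<Union>J. b v = i} \<le> card {v\<in>\<Union>\<C>. b v = i}"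
          using J by (intro card_mono) (auto intro: rev_finite_subset)
        then show "card {v\<in>\<Union>J. b v = i} \<le> 4" using le4[of i] by linarith
      qed
      ultimately have "(card J - card (b ` \<Union>J)) * 4 \<le> t" using count by simp
      then have "card J - card (b ` \<Union>J) \<le> t div 4" by (simp add: less_eq_div_iff_mult_less_eq)
      then have "card J \<le> card (b ` \<Union>J) + t div 4" by simp
      also have "\<dots> = card (Inl ` b ` \<Union>J \<union> Inr ` {..<t div 4} :: ('i + nat) set)"
        using finUJ by (subst card_Un_disjoint) (auto simp: card_image)
      also have "Inl ` b ` \<Union>J \<union> Inr ` {..<t div 4} = (\<Union>C\<in>J. N C)"
        using False unfolding N_def by blast
      finally show ?thesis .
    qed simp
  qed
  then obtain f where f: "inj_on f \<C>" "\<And>C. C \<in> \<C> \<Longrightarrow> f C \<in> N C" by blast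
  define U where "U = {C\<in>\<C>. f C \<in> Inr ` {..<t div 4}}"
  have "card U \<le> card (Inr ` {..<t div 4} :: ('i + nat) set)"
    by (rule card_inj_on_le[of f]) (use f(1) in \<open>auto simp: U_def inj_on_def\<close>)
  then have "4 * card U \<le> t" by (simp add: card_image)
  have "\<exists>x\<in>C. f C = Inl (b x)" if "C \<in> \<C> - U" for C
    using f(2)[of C] that by (auto simp: U_def N_def)
  then obtain X where X: "\<And>C. C \<in> \<C> - U \<Longrightarrow> X C \<in> C \<and> f C = Inl (b (X C))" by metis
  have "inj_on (\<lambda>C. b (X C)) (\<C> - U)"
  proof (rule inj_onI)
    fix C D assume CD: "C \<in> \<C> - U" "D \<in> \<C> - U" "b (X C) = b (X D)"
    then have "f C = f D" using X by metis
    then show "C = D" using inj_onD[OF f(1)] CD by auto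
  qed
  moreover have "U \<subseteq> \<C>" by (auto simp: U_def)
  moreover have "\<forall>C\<in>\<C> - U. X C \<in> C" using X by blast
  ultimately show ?thesis
    using \<open>4 * card U \<le> t\<close> unfolding t_def by (intro exI[of _ U] exI[of _ X] conjI)
qed

text \<open>As long as some member \<open>C\<close> of \<open>\<C>\<close> is missed, the representative of \<open>C\<close> may be exchanged for
  the element of \<open>W\<close> in its block. At most one member of \<open>\<C>\<close> is lost, one is gained, and \<open>W\<close> moves
  closer to the set of representatives.\<close>

lemma hit_all_by_exchange:
  fixes \<C> :: "'a set set" and b :: "'a \<Rightarrow> 'i"
  assumes finV: "finite V" and fin: "finite \<C>"
    and sym: "\<And>x y. E x y \<Longrightarrow> E y x" and irr: "\<And>x. \<not> E x x"
    and disj: "\<And>C D. C \<in> \<C> \<Longrightarrow> D \<in> \<C> \<Longrightarrow> C \<noteq> D \<Longrightarrow> C \<inter> D = {}"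
    and closed: "\<And>C x y. C \<in> \<C> \<Longrightarrow> x \<in> C \<Longrightarrow> E x y \<Longrightarrow> y \<in> C"
    and X: "\<And>C. C \<in> \<C> \<Longrightarrow> X C \<in> C \<inter> V" "inj_on (\<lambda>C. b (X C)) \<C>"
    and W\<^sub>0: "W\<^sub>0 \<subseteq> V" "\<forall>x\<in>W\<^sub>0. \<forall>y\<in>W\<^sub>0. \<not> E x y" "inj_on b W\<^sub>0" "F \<subseteq> b ` W\<^sub>0"
  shows "\<exists>W. W \<subseteq> V \<and> (\<forall>x\<in>W. \<forall>y\<in>W. \<not> E x y) \<and> inj_on b W \<and> F \<subseteq> b ` W \<and> (\<forall>C\<in>\<C>. W \<inter> C \<noteq> {})"
proof -
  define P where "P W \<longleftrightarrow> W \<subseteq> V \<and> (\<forall>x\<in>W. \<forall>y\<in>W. \<not> E x y) \<and> inj_on b W \<and> F \<subseteq> b ` W" for W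
  define hit where "hit W = {C\<in>\<C>. W \<inter> C \<noteq> {}}" for W
  \<comment> \<open>A bounded measure, so that a maximal \<open>W\<close> replaces iterating the
    exchange.\<close>
  define \<mu> where "\<mu> W = card (hit W) + card (W \<inter> X ` \<C>)" for W
  have "P W\<^sub>0" unfolding P_def using W\<^sub>0 by (intro conjI)
  have "\<mu> W \<le> card \<C> + card (X ` \<C>)" for W
    unfolding \<mu>_def hit_def using fin by (intro add_mono card_mono) auto
  then obtain W where W: "P W" and max: "\<And>W'. P W' \<Longrightarrow> \<mu> W' \<le> \<mu> W"
    using ex_has_greatest_nat[of P W\<^sub>0 \<mu> "Suc (card \<C> + card (X ` \<C>))"] \<open>P W\<^sub>0\<close>
    by (auto simp: less_Suc_eq_le)
  have "W \<inter> C \<noteq> {}" if C: "C \<in> \<C>" for C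
  proof
    assume miss: "W \<inter> C = {}"
    define v where "v = X C"
    have v: "v \<in> C" "v \<in> V" "v \<notin> W" using X(1)[OF C] miss unfolding v_def by blast+
    define L where "L = {w\<in>W. b w = b v}"
    define W' where "W' = insert v (W - L)"
    have finW: "finite W" using W finV finite_subset unfolding P_def by blast
    have "P W'"
      unfolding P_def
    proof (intro conjI ballI)
      show "W' \<subseteq> V" using W v by (auto simp: W'_def P_def)
      show "inj_on b W'" using W by (auto simp: W'_def P_def inj_on_def L_def)
      show "F \<subseteq> b ` W'"
      proof
        fix i assume "i \<in> F"
        then obtain w where "w \<in> W" "b w = i" using W unfolding P_def by blast
        then show "i \<in> b ` W'" by (cases "i = b v") (auto simp: W'_def L_def)
      qed
      \<comment> \<open>All neighbours of \<open>v\<close> lie in \<open>C\<close>, which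
        \<open>W\<close> misses.\<close>
      have "\<not> E v y" if "y \<in> W" for y using closed[OF C v(1)] miss that by blast
      then show "\<not> E x y" if "x \<in> W'" "y \<in> W'" for x y
        using that W irr sym unfolding W'_def P_def by blast
    qed
    have Lw: "\<exists>w. L \<subseteq> {w}"
    proof (cases "L = {}")
      case False
      then obtain w where "w \<in> L" by auto
      then have "L \<subseteq> {w}" using W by (auto simp: L_def P_def inj_on_def)
      then show ?thesis by blast
    qed auto
    then obtain w where w: "L \<subseteq> {w}" by blast
    \<comment> \<open>The only representative in the block of \<open>v\<close> is \<open>v\<close>
      itself, so the exchange removes no representative from \<open>W\<close>.\<close>
    have "L \<inter> X ` \<C> = {}"
    proof (rule ccontr)
      assume "L \<inter> X ` \<C> \<noteq> {}"
      then obtain D where D: "D \<in> \<C>" "X D \<in> L" by auto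
      then have "D = C" using inj_onD[OF X(2) _ D(1) C] by (simp add: L_def v_def)
      then show False using D v(3) by (simp add: L_def v_def)
    qed
    then have "W' \<inter> X ` \<C> = insert v (W \<inter> X ` \<C>)" using C by (auto simp: W'_def v_def)
    then have more: "card (W' \<inter> X ` \<C>) = Suc (card (W \<inter> X ` \<C>))"
      using v(3) finW by simp
    have finhit: "finite (hit W)" using fin by (simp add: hit_def)
    \<comment> \<open>Only a member containing \<open>w\<close> can be lost, and by disjointness
      there is at most one; \<open>C\<close> compensates for it.\<close>
    have "insert C (hit W - {D\<in>\<C>. w \<in> D}) \<subseteq> hit W'"
      using w v C by (auto simp: hit_def W'_def)
    moreover have "C \<notin> hit W" using miss by (simp add: hit_def)
    moreover have "card {D\<in>\<C>. w \<in> D} \<le> 1"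
    proof -
      have "finite {D\<in>\<C>. w \<in> D}" using fin by simp
      then show ?thesis using disj by (simp add: card_le_Suc0_iff_eq) blast
    qed
    then have "card (hit W) \<le> Suc (card (hit W - {D\<in>\<C>. w \<in> D}))"
      using diff_card_le_card_Diff[of "{D\<in>\<C>. w \<in> D}" "hit W"] fin by simp
    ultimately have "card (hit W) \<le> card (hit W')"
      using card_mono[of "hit W'" "insert C (hit W - {D\<in>\<C>. w \<in> D})"] fin finhit
      by (simp add: hit_def[of W'])
    then have "\<mu> W < \<mu> W'" using more by (simp add: \<mu>_def)
    then show False using max[OF \<open>P W'\<close>] by simp
  qed
  then show ?thesis using W unfolding P_def by blast
qed

section \<open>Gluing complete graphs into a graph of maximum degree two\<close>

context
  fixes V :: "'a set" and E :: "'a \<Rightarrow> 'a \<Rightarrow> bool"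
  assumes graph: "simple_graph V E" and deg2: "max_degree_le V E 2"
begin

section \<open>Cycle components and triangles\<close>

private lemma finV: "finite V"
  using graph by (simp add: simple_graph_def)

private lemma E_in: "E x y \<Longrightarrow> x \<in> V \<and> y \<in> V"
  using graph unfolding simple_graph_def by blast

private lemma E_sym: "E x y \<Longrightarrow> E y x"
  using graph unfolding simple_graph_def by blast

private lemma E_irr: "\<not> E x x"
  using graph unfolding simple_graph_def by blast

private lemma fin_nbrs: "finite {w. E v w}"
  by (rule finite_subset[OF _ finV]) (use E_in in blast)

private lemma card_nbrs: "card {w. E v w} \<le> 2"
proof (cases "v \<in> V")
  case True
  then show ?thesis using deg2 by (simp add: max_degree_le_def degree_def)
next
  case False
  then have "{w. E v w} = {}" using E_in by blast
  then show ?thesis by simp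
qed

private lemma nbrs_eqI:
  assumes "S \<subseteq> {w. E v w}" "2 \<le> card S"
  shows "S = {w. E v w}"
  using card_seteq[OF fin_nbrs assms(1)] card_nbrs[of v] assms(2) by linarith

private lemma cycle_subset: "cycle_component V E C \<Longrightarrow> C \<subseteq> V"
proof -
  assume "cycle_component V E C"
  then obtain u where u: "u \<in> V" "C = {v. E\<^sup>*\<^sup>* u v}"
    unfolding cycle_component_def component_def by blast
  have "v \<in> V" if "E\<^sup>*\<^sup>* u v" for v
    using that u(1) by (induction rule: rtranclp_induct) (use E_in in blast)+
  then show ?thesis using u(2) by blast
qed

private lemma cycle_closed: "cycle_component V E C \<Longrightarrow> x \<in> C \<Longrightarrow> E x y \<Longrightarrow> y \<in> C"
  unfolding cycle_component_def component_def by (auto intro: rtranclp.rtrancl_into_rtrancl)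

private lemma cycle_nonempty: "cycle_component V E C \<Longrightarrow> C \<noteq> {}"
  unfolding cycle_component_def component_def by blast

private lemma cycle_disjoint:
  assumes "cycle_component V E C" "cycle_component V E D" "C \<noteq> D"
  shows "C \<inter> D = {}"
proof (rule ccontr)
  have rev: "E\<^sup>*\<^sup>* y x" if "E\<^sup>*\<^sup>* x y" for x y
    using that by (induction rule: rtranclp_induct) (auto intro: converse_rtranclp_into_rtranclp dest: E_sym)
  assume "C \<inter> D \<noteq> {}"
  then obtain x where x: "x \<in> C" "x \<in> D" by blast
  have "C' = {v. E\<^sup>*\<^sup>* x v}" if C': "cycle_component V E C'" "x \<in> C'" for C'
  proof -
    obtain u where "C' = {v. E\<^sup>*\<^sup>* u v}" using C'(1) unfolding cycle_component_def component_def by blast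
    then show ?thesis using C'(2) rev by (auto intro: rtranclp_trans)
  qed
  then show False using assms x by blast
qed

private lemma cycle_nbrs: "cycle_component V E C \<Longrightarrow> v \<in> C \<Longrightarrow> card {w. E v w} = 2"
  by (simp add: cycle_component_def degree_def)

private lemma cycle_card_insert:
  assumes "cycle_component V E C" "v \<in> C"
  shows "insert v {w. E v w} \<subseteq> C" "card (insert v {w. E v w}) = 3"
  using cycle_closed[OF assms] assms(2) cycle_nbrs[OF assms] fin_nbrs[of v] E_irr[of v] by auto

private lemma cycle_card_ge_3:
  assumes "cycle_component V E C"
  shows "3 \<le> card C"
proof -
  obtain v where v: "v \<in> C" using cycle_nonempty[OF assms] by blast
  have "finite C" using cycle_subset[OF assms] finV by (rule finite_subset)
  then show ?thesis using card_mono[OF _ cycle_card_insert(1)[OF assms v]] cycle_card_insert(2)[OF assms v] by simp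
qed

private lemma short_cycle_triangle:
  assumes C: "cycle_component V E C" "card C = 3"
  shows "C \<in> triangles V E"
proof -
  have "finite C" using cycle_subset[OF C(1)] finV by (rule finite_subset)
  have "E v w" if vw: "v \<in> C" "w \<in> C" "v \<noteq> w" for v w
  proof -
    have "insert v {w. E v w} = C"
      using card_subset_eq[OF \<open>finite C\<close> cycle_card_insert(1)[OF C(1) vw(1)]]
        cycle_card_insert(2)[OF C(1) vw(1)] C(2) by simp
    then show ?thesis using vw by blast
  qed
  then show ?thesis using C(2) cycle_subset[OF C(1)] by (simp add: triangles_def)
qed

private lemma fin_triangles: "finite (triangles V E)"
  by (rule finite_subset[of _ "Pow V"]) (use finV in \<open>auto simp: triangles_def\<close>)

text \<open>A triangle through \<open>x\<close> consists of \<open>x\<close> and all its neighbours,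
  so distinct triangles are disjoint.\<close>

lemma card_triangles: "3 * card (triangles V E) \<le> card V"
proof -
  have T: "T = insert x {w. E x w}" if "T \<in> triangles V E" "x \<in> T" for T x
  proof -
    have "finite T" "card T = 3" using that by (auto simp: triangles_def intro: card_ge_0_finite)
    then have "card (T - {x}) = 2" using that(2) by simp
    moreover have "T - {x} \<subseteq> {w. E x w}" using that by (auto simp: triangles_def)
    ultimately have "T - {x} = {w. E x w}" by (intro nbrs_eqI) auto
    then show ?thesis using that(2) by blast
  qed
  have "(\<Sum>T\<in>triangles V E. card T) = card (\<Union>(triangles V E))"
  proof (rule card_Union_disjoint[symmetric])
    show "pairwise disjnt (triangles V E)" unfolding pairwise_def disjnt_def using T by blast
    show "finite T" if "T \<in> triangles V E" for T
      using that finV by (auto simp: triangles_def intro: finite_subset)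
  qed
  also have "\<dots> \<le> card V"
    by (rule card_mono[OF finV]) (auto simp: triangles_def)
  also have "(\<Sum>T\<in>triangles V E. card T) = (\<Sum>T\<in>triangles V E. 3)"
    by (intro sum.cong) (auto simp: triangles_def)
  finally show ?thesis by simp
qed

text \<open>Every vertex of \<open>S\<close> has all its neighbours in \<open>S\<close>, so
  \<open>S\<close> contains the whole component of each of its vertices, and this component is
  2-regular.\<close>

private lemma contains_cycle:
  assumes "S \<subseteq> V" "S \<noteq> {}" "\<And>v. v \<in> S \<Longrightarrow> 2 \<le> card {w\<in>S. E v w}"
  shows "\<exists>C. cycle_component V E C \<and> C \<subseteq> S"
proof -
  obtain u where u: "u \<in> S" using assms(2) by blast
  have nbrs: "{w\<in>S. E v w} = {w. E v w}" if "v \<in> S" for v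
    by (rule nbrs_eqI) (use assms(3)[OF that] in auto)
  have inS: "v \<in> S" if "E\<^sup>*\<^sup>* u v" for v
    using that u by (induction rule: rtranclp_induct) (use nbrs in blast)+
  have "card {w. E v w} = 2" if "v \<in> S" for v
    using card_nbrs[of v] assms(3)[OF that] nbrs[OF that] by simp
  then have "cycle_component V E {v. E\<^sup>*\<^sup>* u v}"
    unfolding cycle_component_def component_def degree_def using u assms(1) inS by blast
  then show ?thesis using inS by blast
qed

text \<open>By \<open>contains_cycle\<close>, a set without a complete cycle induces a linear
  forest.\<close>

private lemma three_coloring_off_cycles:
  fixes b :: "'a \<Rightarrow> 'i"
  assumes "S \<subseteq> V" and no_cycle: "\<And>C. cycle_component V E C \<Longrightarrow> \<not> C \<subseteq> S"
    and "\<And>i. card {v\<in>S. b v = i} \<le> 3"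
  shows "\<exists>c :: 'a \<Rightarrow> nat. (\<forall>v. c v < 3)
    \<and> (\<forall>x\<in>S. \<forall>y\<in>S. E x y \<or> (x \<noteq> y \<and> b x = b y) \<longrightarrow> c x \<noteq> c y)"
proof -
  have finS: "finite S" using assms(1) finV by (rule finite_subset)
  have deg: "card {w\<in>S. E v w} \<le> 2" for v
    using card_mono[OF fin_nbrs[of v], of "{w\<in>S. E v w}"] card_nbrs[of v] by fastforce
  have acyc: "\<exists>v\<in>T. card {w\<in>T. E v w} \<le> 1" if T: "T \<subseteq> S" "T \<noteq> {}" for T
  proof (rule ccontr)
    assume "\<not> ?thesis"
    then have "2 \<le> card {w\<in>T. E v w}" if "v \<in> T" for v using that by (auto simp: not_le)
    then obtain C where "cycle_component V E C" "C \<subseteq> T"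
      using contains_cycle[of T] T assms(1) by blast
    then show False using no_cycle T(1) by blast
  qed
  show ?thesis
  proof (rule linear_forest_plus_triples[OF finS E_sym E_irr deg acyc assms(3)])
    fix c :: "'a \<Rightarrow> nat"
    assume c: "\<And>v. c v < 3" "\<And>x y. x \<in> S \<Longrightarrow> y \<in> S \<Longrightarrow> E x y \<Longrightarrow> c x \<noteq> c y"
      "\<And>x y. x \<in> S \<Longrightarrow> y \<in> S \<Longrightarrow> x \<noteq> y \<Longrightarrow> b x = b y \<Longrightarrow> c x \<noteq> c y"
    show ?thesis using c by (intro exI[of _ c] conjI allI ballI impI) blast+
  qed
qed

lemma four_coloring_of_deletion:
  fixes b :: "'a \<Rightarrow> 'i"
  assumes le4: "\<And>i. card {v\<in>V. b v = i} \<le> 4"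
  shows "\<exists>Z c. Z \<subseteq> V \<and> 4 * card Z \<le> card (triangles V E)
    \<and> (\<forall>C. cycle_component V E C \<longrightarrow> card (Z \<inter> C) \<le> 1)
    \<and> (\<forall>v. c v < (4 :: nat))
    \<and> (\<forall>x\<in>V - Z. \<forall>y\<in>V - Z. E x y \<or> (x \<noteq> y \<and> b x = b y) \<longrightarrow> c x \<noteq> c y)"
proof -
  define \<C> where "\<C> = {C. cycle_component V E C}"
  have finC: "finite \<C>"
    by (rule finite_subset[of _ "Pow V"]) (use finV cycle_subset in \<open>auto simp: \<C>_def\<close>)
  have disj: "C \<inter> D = {}" if "C \<in> \<C>" "D \<in> \<C>" "C \<noteq> D" for C D
    using cycle_disjoint that by (simp add: \<C>_def)
  have "\<exists>U X. U \<subseteq> \<C> \<and> 4 * card U \<le> card {C\<in>\<C>. card C = 3}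
    \<and> (\<forall>C\<in>\<C> - U. X C \<in> C) \<and> inj_on (\<lambda>C. b (X C)) (\<C> - U)"
  proof (rule partial_representatives[OF finC _ disj])
    show "finite C" if "C \<in> \<C>" for C
      using cycle_subset[of C] that finV unfolding \<C>_def by (auto intro: finite_subset)
    show "3 \<le> card C" if "C \<in> \<C>" for C using that cycle_card_ge_3 by (simp add: \<C>_def)
    fix i
    have "card {v\<in>\<Union>\<C>. b v = i} \<le> card {v\<in>V. b v = i}"
      by (rule card_mono) (use finV cycle_subset in \<open>auto simp: \<C>_def\<close>)
    then show "card {v\<in>\<Union>\<C>. b v = i} \<le> 4" using le4[of i] by linarith
  qed
  then obtain U X where U: "U \<subseteq> \<C>" "4 * card U \<le> card {C\<in>\<C>. card C = 3}"
    and X: "\<forall>C\<in>\<C> - U. X C \<in> C" "inj_on (\<lambda>C. b (X C)) (\<C> - U)"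
    by (elim exE conjE)
  \<comment> \<open>An arbitrary vertex of each cycle; it is deleted from the cycles left without a
    representative.\<close>
  define z where "z C = (SOME v. v \<in> C)" for C :: "'a set"
  have z: "z C \<in> C" if "C \<in> \<C>" for C
    using that cycle_nonempty unfolding z_def \<C>_def by (simp add: some_in_eq)
  define Z where "Z = z ` U"
  define V' where "V' = V - Z"
  have "finite U" using U(1) finC by (rule finite_subset)
  then have cardZ: "card Z \<le> card U" unfolding Z_def by (rule card_image_le)
  have "card {C\<in>\<C>. card C = 3} \<le> card (triangles V E)"
    by (rule card_mono[OF fin_triangles]) (use short_cycle_triangle in \<open>auto simp: \<C>_def\<close>)
  then have few: "4 * card Z \<le> card (triangles V E)" using cardZ U(2) by linarith
  have "Z \<subseteq> V" using z U(1) cycle_subset unfolding Z_def \<C>_def by blast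
  have Z_Int: "Z \<inter> C \<subseteq> {z C}" if "C \<in> \<C>" for C
    using disj[OF _ that] z U(1) unfolding Z_def by blast
  have Z_miss: "Z \<inter> C = {}" if "C \<in> \<C> - U" for C
    using disj[of _ C] z U(1) that unfolding Z_def by blast
  have finV': "finite V'" using finV by (simp add: V'_def)
  have le4': "card {v\<in>V'. b v = i} \<le> 4" for i
  proof -
    have "card {v\<in>V'. b v = i} \<le> card {v\<in>V. b v = i}"
      by (rule card_mono) (use finV in \<open>auto simp: V'_def\<close>)
    then show ?thesis using le4[of i] by linarith
  qed
  define F where "F = {i. card {v\<in>V'. b v = i} = 4}"
  \<comment> \<open>Used twice: for the representatives \<open>D\<close>, to find an independent
    set, and for the final fourth color class \<open>W\<close>.\<close>
  have remove: "\<exists>c :: 'a \<Rightarrow> nat. (\<forall>v. c v < 3)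
    \<and> (\<forall>x\<in>V' - D. \<forall>y\<in>V' - D. E x y \<or> (x \<noteq> y \<and> b x = b y) \<longrightarrow> c x \<noteq> c y)"
    if D: "D \<subseteq> V'" "F \<subseteq> b ` D" "\<forall>C\<in>\<C> - U. D \<inter> C \<noteq> {}" for D
  proof (rule three_coloring_off_cycles)
    show "V' - D \<subseteq> V" by (auto simp: V'_def)
    show "\<not> C \<subseteq> V' - D" if "cycle_component V E C" for C
    proof (cases "C \<in> U")
      case True
      then have "z C \<in> C \<inter> Z" using z U(1) by (auto simp: Z_def)
      then show ?thesis by (auto simp: V'_def)
    next
      case False
      then show ?thesis using D(3) that by (auto simp: \<C>_def)
    qed
    show "card {v\<in>V' - D. b v = i} \<le> 3" for i
    proof (cases "i \<in> F")
      case True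
      then obtain d where d: "d \<in> D" "b d = i" using D(2) by blast
      then have "{v\<in>V' - D. b v = i} \<subset> {v\<in>V'. b v = i}" using D(1) by blast
      then have "card {v\<in>V' - D. b v = i} < card {v\<in>V'. b v = i}"
        using finV' by (intro psubset_card_mono) auto
      then show ?thesis using le4'[of i] by linarith
    next
      case False
      have "card {v\<in>V' - D. b v = i} \<le> card {v\<in>V'. b v = i}"
        by (rule card_mono) (use finV' in auto)
      then show ?thesis using le4'[of i] False by (simp add: F_def)
    qed
  qed
  have X': "X C \<in> C \<inter> V'" if "C \<in> \<C> - U" for C
  proof -
    have "X C \<in> C" "C \<subseteq> V" using X(1) that cycle_subset by (auto simp: \<C>_def)
    then show ?thesis using Z_miss[OF that] unfolding V'_def by blast
  qed
  \<comment> \<open>One vertex per block: the representative of a cycle if the block holds one,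
    otherwise any vertex of the block.\<close>
  define d where "d i = (if i \<in> b ` X ` (\<C> - U) then SOME x. x \<in> X ` (\<C> - U) \<and> b x = i
    else SOME v. v \<in> V' \<and> b v = i)" for i
  define D where "D = d ` (b ` X ` (\<C> - U) \<union> F)"
  have d1: "d (b x) = x" if x: "x \<in> X ` (\<C> - U)" for x
  proof -
    have "d (b x) = (SOME y. y \<in> X ` (\<C> - U) \<and> b y = b x)" using x by (simp add: d_def)
    also have "\<dots> = x"
    proof (rule some_equality)
      show "x \<in> X ` (\<C> - U) \<and> b x = b x" using x by blast
      show "y = x" if "y \<in> X ` (\<C> - U) \<and> b y = b x" for y
        using that x inj_onD[OF X(2)] by blast
    qed
    finally show ?thesis .
  qed
  have d2: "d i \<in> V' \<and> b (d i) = i" if i: "i \<in> b ` X ` (\<C> - U) \<union> F" for i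
  proof (cases "i \<in> b ` X ` (\<C> - U)")
    case True
    then obtain x where "x \<in> X ` (\<C> - U)" "i = b x" by blast
    then show ?thesis using d1[of x] X' by auto
  next
    case False
    then have "card {v\<in>V'. b v = i} \<noteq> 0" using i by (simp add: F_def)
    then have "{v\<in>V'. b v = i} \<noteq> {}" by (intro notI) simp
    then have "\<exists>v. v \<in> V' \<and> b v = i" by blast
    from someI_ex[OF this] show ?thesis using False by (simp add: d_def)
  qed
  have "D \<subseteq> V'" using d2 unfolding D_def by blast
  have "F \<subseteq> b ` D"
  proof
    fix i assume i: "i \<in> F"
    then have "d i \<in> D" "i = b (d i)" using d2[of i] by (auto simp: D_def)
    then show "i \<in> b ` D" by (rule rev_image_eqI)
  qed
  have "X ` (\<C> - U) \<subseteq> D"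
  proof
    fix x assume x: "x \<in> X ` (\<C> - U)"
    then have "d (b x) \<in> D" unfolding D_def by blast
    then show "x \<in> D" using d1[OF x] by simp
  qed
  then have D_hits: "\<forall>C\<in>\<C> - U. D \<inter> C \<noteq> {}" using X' by blast
  obtain c\<^sub>0 :: "'a \<Rightarrow> nat" where c\<^sub>0: "\<forall>v. c\<^sub>0 v < 3"
    "\<forall>x\<in>V' - D. \<forall>y\<in>V' - D. E x y \<or> (x \<noteq> y \<and> b x = b y) \<longrightarrow> c\<^sub>0 x \<noteq> c\<^sub>0 y"
    using remove[OF \<open>D \<subseteq> V'\<close> \<open>F \<subseteq> b ` D\<close> D_hits] by (elim exE conjE)
  \<comment> \<open>\<open>D\<close> may contain adjacent vertices and so cannot serve as a color
    class. One class of the coloring outside \<open>D\<close> is independent, but it may miss cycles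
    until the exchange.\<close>
  define W\<^sub>0 where "W\<^sub>0 = {v\<in>V' - D. c\<^sub>0 v = 0}"
  have "\<exists>W. W \<subseteq> V' \<and> (\<forall>x\<in>W. \<forall>y\<in>W. \<not> E x y) \<and> inj_on b W \<and> F \<subseteq> b ` W
    \<and> (\<forall>C\<in>\<C> - U. W \<inter> C \<noteq> {})"
  proof (rule hit_all_by_exchange)
    show "finite V'" "finite (\<C> - U)" using finV' finC by auto
    show "C \<inter> C' = {}" if "C \<in> \<C> - U" "C' \<in> \<C> - U" "C \<noteq> C'" for C C'
      using that disj by blast
    show "y \<in> C" if "C \<in> \<C> - U" "x \<in> C" "E x y" for C x y
      using that cycle_closed unfolding \<C>_def by blast
    show "W\<^sub>0 \<subseteq> V'" by (auto simp: W\<^sub>0_def)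
    show "\<forall>x\<in>W\<^sub>0. \<forall>y\<in>W\<^sub>0. \<not> E x y"
    proof (intro ballI)
      fix x y assume "x \<in> W\<^sub>0" "y \<in> W\<^sub>0"
      then show "\<not> E x y" using c\<^sub>0(2)[rule_format, of x y] by (auto simp: W\<^sub>0_def)
    qed
    show "inj_on b W\<^sub>0"
    proof (rule inj_onI)
      fix x y assume "x \<in> W\<^sub>0" "y \<in> W\<^sub>0" "b x = b y"
      then show "x = y" using c\<^sub>0(2)[rule_format, of x y] by (auto simp: W\<^sub>0_def)
    qed
    show "F \<subseteq> b ` W\<^sub>0"
    proof
      fix i assume i: "i \<in> F"
      \<comment> \<open>A block of size 4 loses only \<open>d i\<close> to \<open>D\<close>; its
        other three vertices use all three colors, among them 0.\<close>
      define B where "B = {v\<in>V' - D. b v = i}"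
      have "{v\<in>V'. b v = i} = insert (d i) B"
      proof
        show "{v\<in>V'. b v = i} \<subseteq> insert (d i) B"
        proof
          fix v assume v: "v \<in> {v\<in>V'. b v = i}"
          show "v \<in> insert (d i) B"
          proof (cases "v \<in> D")
            case True
            then obtain j where "v = d j" "j \<in> b ` X ` (\<C> - U) \<union> F" unfolding D_def by blast
            then show ?thesis using d2[of j] v by auto
          qed (use v in \<open>auto simp: B_def\<close>)
        qed
        show "insert (d i) B \<subseteq> {v\<in>V'. b v = i}" using d2[of i] i by (auto simp: B_def)
      qed
      moreover have "d i \<notin> B" using i by (auto simp: B_def D_def)
      moreover have "finite B" using finV' by (simp add: B_def)
      ultimately have "card B = 3" using i by (simp add: F_def)
      have inj: "inj_on c\<^sub>0 B"
      proof (rule inj_onI)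
        fix x y assume "x \<in> B" "y \<in> B" "c\<^sub>0 x = c\<^sub>0 y"
        then show "x = y" using c\<^sub>0(2)[rule_format, of x y] by (auto simp: B_def)
      qed
      have "c\<^sub>0 ` B \<subseteq> {..<3}" using c\<^sub>0(1) by blast
      then have "c\<^sub>0 ` B = {..<3}"
        using card_image[OF inj] \<open>card B = 3\<close> by (intro card_subset_eq) auto
      then have "0 \<in> c\<^sub>0 ` B" by simp
      then show "i \<in> b ` W\<^sub>0" by (force simp: B_def W\<^sub>0_def)
    qed
  qed (use E_sym E_irr X' X(2) in blast)+
  then obtain W where W: "W \<subseteq> V'" "\<forall>x\<in>W. \<forall>y\<in>W. \<not> E x y" "inj_on b W" "F \<subseteq> b ` W"
    "\<forall>C\<in>\<C> - U. W \<inter> C \<noteq> {}"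
    by (elim exE conjE)
  obtain c\<^sub>1 :: "'a \<Rightarrow> nat" where c\<^sub>1: "\<forall>v. c\<^sub>1 v < 3"
    "\<forall>x\<in>V' - W. \<forall>y\<in>V' - W. E x y \<or> (x \<noteq> y \<and> b x = b y) \<longrightarrow> c\<^sub>1 x \<noteq> c\<^sub>1 y"
    using remove[OF W(1,4,5)] by (elim exE conjE)
  \<comment> \<open>\<open>W\<close> receives the fourth color, numbered 3.\<close>
  define c where "c v = (if v \<in> W then 3 else c\<^sub>1 v)" for v
  have "c v < 4" for v using c\<^sub>1(1)[rule_format, of v] by (simp add: c_def)
  moreover have "c x \<noteq> c y" if xy: "x \<in> V'" "y \<in> V'" "E x y \<or> (x \<noteq> y \<and> b x = b y)" for x y
  proof (cases "x \<in> W"; cases "y \<in> W")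
    assume "x \<in> W" "y \<in> W"
    then show ?thesis using xy(3) W(2) inj_onD[OF W(3)] by blast
  next
    assume "x \<notin> W" "y \<notin> W"
    then show ?thesis using xy c\<^sub>1(2)[rule_format, of x y] by (simp add: c_def)
  qed (use c\<^sub>1(1)[rule_format, of x] c\<^sub>1(1)[rule_format, of y] in \<open>auto simp: c_def\<close>)
  moreover have "card (Z \<inter> C) \<le> 1" if "cycle_component V E C" for C
    using card_mono[OF _ Z_Int[of C]] that by (simp add: \<C>_def)
  ultimately show ?thesis
    using few \<open>Z \<subseteq> V\<close> unfolding V'_def by (intro exI[of _ Z] exI[of _ c] conjI allI ballI impI) blast+
qed

end

theorem theorem4p1:
  fixes V :: "'a set" and E :: "'a \<Rightarrow> 'a \<Rightarrow> bool"
    and Y :: "nat \<Rightarrow> 'a set" and q :: nat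
  assumes "simple_graph V E"
    and "max_degree_le V E 2"
    and "\<forall>j<q. Y j \<subseteq> V \<and> card (Y j) = 4"
    and "\<forall>i<q. \<forall>j<q. i \<noteq> j \<longrightarrow> Y i \<inter> Y j = {}"
  shows "\<exists>Z. Z \<subseteq> V
      \<and> real (card Z) \<le> real (card (triangles V E)) / 4
      \<and> (\<forall>C. cycle_component V E C \<longrightarrow> card (Z \<inter> C) \<le> 1)
      \<and> chromatic_number (V - Z) (glue_K4 E Y q) \<le> 4
      \<and> real (card (V - Z)) \<ge> 11 / 12 * real (card V)"
proof -
  have finV: "finite V" using assms(1) by (simp add: simple_graph_def)
  \<comment> \<open>\<open>Inl\<close> marks the glued sets and \<open>Inr\<close> the singleton
    blocks. The index under \<open>SOME\<close> is unique because the sets are disjoint.\<close>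
  define b :: "'a \<Rightarrow> nat + 'a" where
    "b v = (if \<exists>j<q. v \<in> Y j then Inl (SOME j. j < q \<and> v \<in> Y j) else Inr v)" for v
  have b_Inl: "b v = Inl j" if "j < q" "v \<in> Y j" for v j
  proof -
    have "(SOME i. i < q \<and> v \<in> Y i) = j"
      by (rule some_equality) (use that assms(4) in blast)+
    then show ?thesis using that by (auto simp: b_def)
  qed
  have b_Inr: "b v = Inr v" if "\<not> (\<exists>j<q. v \<in> Y j)" for v
    unfolding b_def by (rule if_not_P[OF that])
  have le4: "card {v\<in>V. b v = i} \<le> 4" for i
  proof (cases "\<exists>j<q. i = Inl j")
    case True
    then obtain j where j: "j < q" "i = Inl j" by blast
    have "v \<in> Y j" if "b v = Inl j" for v
    proof (cases "\<exists>k<q. v \<in> Y k")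
      case True
      then show ?thesis using b_Inl that by auto
    qed (use that b_Inr in auto)
    then have "{v\<in>V. b v = i} \<subseteq> Y j" using j(2) by blast
    moreover have "finite (Y j)" using assms(3) j(1) by (intro card_ge_0_finite) simp
    ultimately show ?thesis using card_mono assms(3) j(1) by metis
  next
    case False
    have "b v = Inr v" if "b v = i" for v
    proof (cases "\<exists>k<q. v \<in> Y k")
      case True
      then show ?thesis using b_Inl that False by auto
    qed (rule b_Inr)
    then have "{v\<in>V. b v = i} \<subseteq> (case i of Inl _ \<Rightarrow> {} | Inr v \<Rightarrow> {v})"
      by (auto split: sum.splits)
    then have "card {v\<in>V. b v = i} \<le> card (case i of Inl _ \<Rightarrow> {} | Inr v \<Rightarrow> {v})"
      by (intro card_mono) (auto split: sum.splits)
    also have "\<dots> \<le> 4" by (auto split: sum.splits)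
    finally show ?thesis .
  qed
  obtain Z c where Z: "Z \<subseteq> V" "4 * card Z \<le> card (triangles V E)"
    "\<forall>C. cycle_component V E C \<longrightarrow> card (Z \<inter> C) \<le> 1"
    and c: "\<forall>v. c v < (4 :: nat)"
    "\<forall>x\<in>V - Z. \<forall>y\<in>V - Z. E x y \<or> (x \<noteq> y \<and> b x = b y) \<longrightarrow> c x \<noteq> c y"
    using four_coloring_of_deletion[OF assms(1,2) le4] by (elim exE conjE)
  have "colorable (V - Z) (glue_K4 E Y q) 4"
    unfolding colorable_def
  proof (intro exI[of _ c] conjI ballI impI)
    fix x y assume "x \<in> V - Z" "y \<in> V - Z" "glue_K4 E Y q x y"
    moreover from this(3) have "E x y \<or> (x \<noteq> y \<and> b x = b y)"
      using b_Inl unfolding glue_K4_def by metis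
    ultimately show "c x \<noteq> c y" using c(2) by blast
  qed (use c(1) in blast)
  then have "chromatic_number (V - Z) (glue_K4 E Y q) \<le> 4"
    unfolding chromatic_number_def by (rule Least_le)
  moreover have "card (V - Z) = card V - card Z" "card Z \<le> card V"
    using Z(1) finV by (auto simp: card_Diff_subset finite_subset card_mono)
  \<comment> \<open>\<open>Z\<close> is at most a quarter of the number of triangles, which is at
    most a third of the number of vertices.\<close>
  moreover have "12 * card Z \<le> card V"
    using Z(2) card_triangles[OF assms(1,2)] by linarith
  ultimately show ?thesis
    using Z by (intro exI[of _ Z] conjI) (simp_all add: of_nat_diff)
qed

end
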